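(* With notation as in the context, \[ Z_{\mathscr{AB}}:=q^{-|\mathrm{II}|-2|\mathrm{III}|}\sum_{(A,B)\in\mathscr{AB}}q^{|A|+|B|}=W(\mu_1,\mu_2,\mu_3). \]
   Context: Fix partitions $\mu_1,\mu_2,\mu_3$; for a partition $\lambda$ put $\lambda_t=0$ for $t>\ell(\lambda)$ and identify $\lambda$ with $\{(u,v)\in\mathbb{Z}^2: v\ge0,\ 0\le u<\lambda_{v+1}\}$. Cells are elements of $\mathbb{Z}^3$; two cells are adjacent if they differ by $\pm e_i$; $BN(w)=\{w-e_1,w-e_2,w-e_3\}$. Define $\mathrm{Cyl}_1=\{(x,u,v):(u,v)\in\mu_1\}$, $\mathrm{Cyl}_2=\{(v,y,u):(u,v)\in\mu_2\}$, $\mathrm{Cyl}_3=\{(u,v,z):(u,v)\in\mu_3\}$, $\mathrm{Cyl}_i^-=\mathrm{Cyl}_i\setminus\mathbb{Z}^3_{\ge0}$, $\mathrm{I}^-=\bigcup_i\mathrm{Cyl}_i^-$, $\mathrm{II}_{\bar1}=\mathrm{Cyl}_2\cap\mathrm{Cyl}_3\setminus\mathrm{Cyl}_1$, $\mathrm{II}_{\bar2}=\mathrm{Cyl}_3\cap\mathrm{Cyl}_1\setminus\mathrm{Cyl}_2$, $\mathrm{II}_{\bar3}=\mathrm{Cyl}_1\cap\mathrm{Cyl}_2\setminus\mathrm{Cyl}_3$, $\mathrm{II}=\bigcup_i\mathrm{II}_{\bar i}$, $\mathrm{III}=\mathrm{Cyl}_1\cap\mathrm{Cyl}_2\cap\mathrm{Cyl}_3$.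 Labelled box configurations. Let $V=\mathbb{C}^3/\mathbb{C}(1,1,1)$, identified at every cell $w$ with $V_w$; $\mathbb{P}^1_w$ = lines in $V_w$; $\langle\mathbf i\rangle$ = line spanned by the image of the $i$-th basis vector. A labelled box configuration $\pi$ is a finite set $B\subseteq\mathrm{I}^-\cup\mathrm{II}\cup\mathrm{III}$ of boxes, a subset $U\subseteq B\cap\mathrm{III}$ of unlabelled boxes, and a label in $\mathbb{P}^1_w$ for each $w\in(B\cap\mathrm{III})\setminus U$, satisfying: (1) if $w\in\mathrm{I}^-$ and some cell of $BN(w)$ is a box, $w$ is a box; (2) if $w\in\mathrm{II}_{\bar i}$ and some $n\in BN(w)$ is a box that is not a type III box labelled $\langle\mathbf i\rangle$, $w$ is a box; (3) for $w\in\mathrm{III}$, let $S$ be the span of subspaces induced by boxes in $BN(w)$ (a box in $\mathrm{Cyl}_j^-$ induces $\langle\mathbf j\rangle$, a labelled type III box its label, an unlabelled type III box all of $V$); if $S\neq0$, $w$ is a box; if $\dim S=1$, $w$ is labelled $S$ or unlabelled; if $\dim S=2$, $w$ is unlabelled. Set $|\pi|=|B|+|U|$; $\chi_{\mathrm{top}}(\pi)$ is the topological Euler characteristic of the moduli space of labellings of $\pi$ (all labelled box configurations with the same $B,U$), and $W(\mu_1,\mu_2,\mu_3)=q^{-|\mathrm{II}|-2|\mathrm{III}|}\sum_\pi\chi_{\mathrm{top}}(\pi)q^{|\pi|}$, each family of labellings (each admissible $(B,U)$) counted once. AB configurations. An AB configuration is a pair $(A,B)$ of finite sets $A\subseteq\mathrm{I}^-\cup\mathrm{III}$,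 $B\subseteq\mathrm{II}\cup\mathrm{III}$ such that: if $w\in\mathrm{I}^-\cup\mathrm{III}$ and $BN(w)\cap A\ne\emptyset$ then $w\in A$; if $w\in\mathrm{II}\cup\mathrm{III}$ and $BN(w)\cap B\neq\emptyset$ then $w\in B$. For a labelled box configuration $\pi$, $AB_{\mathrm{base}}(\pi)=(A,B)$ where $A$ is the set of boxes of $\pi$ in $\mathrm{I}^-\cup\mathrm{III}$ and $B$ is the set of type II boxes together with the unlabelled type III boxes. Define $P(A,B)=(A\cup(\mathrm{III}\cap(B\setminus A)),\ B\setminus(\mathrm{III}\cap(B\setminus A)))$. Let $\mathscr{AB}$ be the set of AB configurations $(A,B)$ such that $P(A,B)=AB_{\mathrm{base}}(\pi)$ for some labelled box configuration $\pi$. *)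

theory Defs
  imports
    "HOL-Analysis.Analysis"
    "HOL-Homology.Homology"
    "HOL-Computational_Algebra.Formal_Laurent_Series"
begin

no_notation fps_nth (infixl \<open>$\<close> 75)

section \<open>Cells\<close>

text \<open>Indices \<open>1, 2, 3\<close> are the elements of the type \<^typ>\<open>3\<close>, whose arithmetic is modulo 3
  (so \<open>3 = 0\<close> there); cells are elements of \<^typ>\<open>int^3\<close>.\<close>

type_synonym cell = "int^3"

definition is_partition :: "nat list \<Rightarrow> bool" where
  "is_partition \<nu> \<longleftrightarrow> sorted_wrt (\<ge>) \<nu> \<and> 0 \<notin> set \<nu>"

text \<open>\<open>\<nu> ! v\<close> is the part \<open>\<nu>\<^bsub>v+1\<^esub>\<close>; the parts beyond the length are \<open>0\<close> and contribute nothing.\<close>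

definition diagram :: "nat list \<Rightarrow> (int \<times> int) set" where
  "diagram \<nu> = {(u, v). 0 \<le> v \<and> nat v < length \<nu> \<and> 0 \<le> u \<and> u < int (\<nu> ! nat v)}"

definition BN :: "cell \<Rightarrow> cell set" where
  "BN w = {w - axis 1 1, w - axis 2 1, w - axis 3 1}"

definition Cyl :: "(3 \<Rightarrow> nat list) \<Rightarrow> 3 \<Rightarrow> cell set" where
  "Cyl \<mu> i =
    (if i = 1 then {vector [x, u, v] | x u v. (u, v) \<in> diagram (\<mu> 1)}
     else if i = 2 then {vector [v, y, u] | y u v. (u, v) \<in> diagram (\<mu> 2)}
     else {vector [u, v, z] | z u v. (u, v) \<in> diagram (\<mu> 3)})"

definition Cyl_neg :: "(3 \<Rightarrow> nat list) \<Rightarrow> 3 \<Rightarrow> cell set" where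
  "Cyl_neg \<mu> i = Cyl \<mu> i - {w. \<forall>j. 0 \<le> w $ j}"

definition I_neg :: "(3 \<Rightarrow> nat list) \<Rightarrow> cell set" where
  "I_neg \<mu> = (\<Union>i. Cyl_neg \<mu> i)"

definition II_bar :: "(3 \<Rightarrow> nat list) \<Rightarrow> 3 \<Rightarrow> cell set" where
  "II_bar \<mu> i = Cyl \<mu> (i + 1) \<inter> Cyl \<mu> (i + 2) - Cyl \<mu> i"

definition II :: "(3 \<Rightarrow> nat list) \<Rightarrow> cell set" where
  "II \<mu> = (\<Union>i. II_bar \<mu> i)"

definition III :: "(3 \<Rightarrow> nat list) \<Rightarrow> cell set" where
  "III \<mu> = Cyl \<mu> 1 \<inter> Cyl \<mu> 2 \<inter> Cyl \<mu> 3"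


section \<open>The plane \<open>\<complex>\<^sup>3 / \<complex>(1,1,1)\<close> and its projective line\<close>

definition V_rel :: "complex^3 \<Rightarrow> complex^3 \<Rightarrow> bool" where
  "V_rel x y \<longleftrightarrow> x - y \<in> vec.span {vec 1}"

lemma equivp_V_rel: "equivp V_rel"
proof (rule equivpI)
  show "reflp V_rel" by (auto simp: reflp_def V_rel_def vec.span_zero)
  show "symp V_rel"
    unfolding symp_def V_rel_def by (metis minus_diff_eq vec.span_neg)
  show "transp V_rel"
  proof (rule transpI)
    fix x y z assume "V_rel x y" "V_rel y z"
    then have "(x - y) + (y - z) \<in> vec.span {vec 1}"
      unfolding V_rel_def by (rule vec.span_add)
    then show "V_rel x z" by (simp add: V_rel_def)
  qed
qed

quotient_type V = "complex^3" / V_rel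
  by (rule equivp_V_rel)

instantiation V :: ab_group_add
begin

lift_definition zero_V :: V is 0 .

lift_definition plus_V :: "V \<Rightarrow> V \<Rightarrow> V" is "(+)"
  unfolding V_rel_def by (metis add_diff_add vec.span_add)

lift_definition uminus_V :: "V \<Rightarrow> V" is uminus
  unfolding V_rel_def by (metis minus_diff_minus vec.span_neg)

lift_definition minus_V :: "V \<Rightarrow> V \<Rightarrow> V" is "(-)"
proof -
  fix a b c d assume "V_rel a b" "V_rel c d"
  moreover have "a - c - (b - d) = (a - b) - (c - d)" by simp
  ultimately show "V_rel (a - c) (b - d)" unfolding V_rel_def by (metis vec.span_diff)
qed

instance
  by standard (transfer, simp add: V_rel_def vec.span_zero algebra_simps)+

end

lift_definition scaleV :: "complex \<Rightarrow> V \<Rightarrow> V" is "(*s)"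
  unfolding V_rel_def by (metis vec.scale_right_diff_distrib vec.span_scale)

global_interpretation V: vector_space scaleV
  defines V_span = V.span and V_subspace = V.subspace and V_dim = V.dim
  by standard
    (transfer, simp add: V_rel_def vec.span_zero vec.scale_right_distrib vec.scale_left_distrib)+

definition basis_line :: "3 \<Rightarrow> V set" where
  "basis_line i = V.span {abs_V (axis i 1)}"

definition V_lines :: "V set set" where
  "V_lines = {L. V.subspace L \<and> V.dim L = 1}"

definition quotient_topology :: "'a topology \<Rightarrow> ('a \<Rightarrow> 'b) \<Rightarrow> 'b topology" where
  "quotient_topology X f =
    topology (\<lambda>S. S \<subseteq> f ` topspace X \<and> openin X {x \<in> topspace X. f x \<in> S})"

definition V_topology :: "V topology" where
  "V_topology = quotient_topology euclidean abs_V"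

definition P1_topology :: "V set topology" where
  "P1_topology = quotient_topology (subtopology V_topology (- {0})) (\<lambda>v. V.span {v})"

lemma openin_quotient_topology:
  "openin (quotient_topology X f) S \<longleftrightarrow>
    S \<subseteq> f ` topspace X \<and> openin X {x \<in> topspace X. f x \<in> S}"
proof -
  have "istopology (\<lambda>S. S \<subseteq> f ` topspace X \<and> openin X {x \<in> topspace X. f x \<in> S})"
    unfolding istopology_def
  proof (intro conjI allI impI; (elim conjE)?)
    fix S T
    assume "openin X {x \<in> topspace X. f x \<in> S}" "openin X {x \<in> topspace X. f x \<in> T}"
    then have "openin X ({x \<in> topspace X. f x \<in> S} \<inter> {x \<in> topspace X. f x \<in> T})" by blast
    then show "openin X {x \<in> topspace X. f x \<in> S \<inter> T}"
      by (rule back_subst) auto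
  next
    fix K assume "\<forall>S\<in>K. S \<subseteq> f ` topspace X \<and> openin X {x \<in> topspace X. f x \<in> S}"
    then have "openin X (\<Union>S\<in>K. {x \<in> topspace X. f x \<in> S})" by blast
    then show "openin X {x \<in> topspace X. f x \<in> \<Union> K}"
      by (rule back_subst) auto
  qed auto
  then show ?thesis by (simp add: quotient_topology_def)
qed

lemma topspace_quotient_topology [simp]: "topspace (quotient_topology X f) = f ` topspace X"
proof
  show "topspace (quotient_topology X f) \<subseteq> f ` topspace X"
    using openin_topspace[of "quotient_topology X f"] unfolding openin_quotient_topology by (rule conjunct1)
  have "openin (quotient_topology X f) (f ` topspace X)"
    unfolding openin_quotient_topology by (simp cong: conj_cong)
  then show "f ` topspace X \<subseteq> topspace (quotient_topology X f)"
    by (rule openin_subset)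
qed

lemma quotient_map_quotient_topology: "quotient_map X (quotient_topology X f) f"
  by (auto simp: quotient_map_def openin_quotient_topology)

lemma topspace_V_topology [simp]: "topspace V_topology = UNIV"
proof -
  have "v \<in> range abs_V" for v by (induct v rule: V.abs_induct) blast
  then show ?thesis by (auto simp: V_topology_def)
qed

lemma topspace_P1_topology [simp]: "topspace P1_topology = V_lines"
proof -
  have 1: "V.span {v} \<in> V_lines" if "v \<noteq> 0" for v
    using that V.dim_eq_card[of "{v}" "{v}"] by (simp add: V_lines_def)
  have 2: "\<exists>v. v \<noteq> 0 \<and> L = V.span {v}" if "L \<in> V_lines" for L
  proof -
    from that have L: "V.subspace L" "V.dim L = 1" by (auto simp: V_lines_def)
    obtain b where b: "b \<subseteq> L" "V.independent b" "L \<subseteq> V.span b" "card b = V.dim L"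
      using V.basis_exists by blast
    then obtain v where "b = {v}" using L(2) by (metis card_1_singletonE)
    with b L(1) have "L = V.span {v}" by (metis V.span_minimal subset_antisym)
    moreover have "v \<noteq> 0" using b(2) \<open>b = {v}\<close> by simp
    ultimately show ?thesis by blast
  qed
  have "(\<lambda>v. V.span {v}) ` (- {0}) = V_lines"
  proof (intro equalityI subsetI)
    fix L assume "L \<in> V_lines"
    then obtain v where "v \<noteq> 0" "L = V.span {v}" using 2 by blast
    then show "L \<in> (\<lambda>v. V.span {v}) ` (- {0})" by (intro image_eqI[of _ _ v]) simp_all
  qed (use 1 in auto)
  then show ?thesis by (simp add: P1_topology_def)
qed


section \<open>Topological Euler characteristic\<close>

text \<open>The alternating sum of Betti numbers, i.e. of the ranks of the integral singular homology
  groups. The definitions are meaningful for spaces whose total homology has finite rank.\<close>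

definition int_independent :: "('a, 'b) monoid_scheme \<Rightarrow> 'a set \<Rightarrow> bool" where
  "int_independent G S \<longleftrightarrow> finite S \<and> S \<subseteq> carrier G \<and>
    (\<forall>c :: 'a \<Rightarrow> int. finprod G (\<lambda>x. x [^]\<^bsub>G\<^esub> c x) S = \<one>\<^bsub>G\<^esub> \<longrightarrow> (\<forall>x\<in>S. c x = 0))"

definition abelian_rank :: "('a, 'b) monoid_scheme \<Rightarrow> nat" where
  "abelian_rank G = Sup (card ` {S. int_independent G S})"

definition betti :: "nat \<Rightarrow> 'a topology \<Rightarrow> nat" where
  "betti p X = abelian_rank (homology_group (int p) X)"

definition euler_characteristic :: "'a topology \<Rightarrow> int" where
  "euler_characteristic X = (\<Sum>p | betti p X \<noteq> 0. (-1) ^ p * int (betti p X))"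


section \<open>Labelled box configurations\<close>

text \<open>A configuration is given by its set \<open>B\<close> of boxes, the set \<open>U\<close> of unlabelled boxes and
  the labelling \<open>l\<close>, which is \<^const>\<open>undefined\<close> off the labelled boxes so that distinct functions
  are distinct labellings.\<close>

definition labelled_boxes :: "(3 \<Rightarrow> nat list) \<Rightarrow> cell set \<Rightarrow> cell set \<Rightarrow> cell set" where
  "labelled_boxes \<mu> B U = (B \<inter> III \<mu>) - U"

definition induced :: "(3 \<Rightarrow> nat list) \<Rightarrow> cell set \<Rightarrow> (cell \<Rightarrow> V set) \<Rightarrow> cell \<Rightarrow> V set" where
  "induced \<mu> U l n =
    (if n \<in> III \<mu> then (if n \<in> U then UNIV else l n)
     else (\<Union>j\<in>{j. n \<in> Cyl_neg \<mu> j}. basis_line j))"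

definition induced_span ::
  "(3 \<Rightarrow> nat list) \<Rightarrow> cell set \<Rightarrow> cell set \<Rightarrow> (cell \<Rightarrow> V set) \<Rightarrow> cell \<Rightarrow> V set" where
  "induced_span \<mu> B U l w = V.span (\<Union>n \<in> BN w \<inter> B. induced \<mu> U l n)"

definition is_lbc ::
  "(3 \<Rightarrow> nat list) \<Rightarrow> cell set \<Rightarrow> cell set \<Rightarrow> (cell \<Rightarrow> V set) \<Rightarrow> bool" where
  "is_lbc \<mu> B U l \<longleftrightarrow>
    finite B \<and> B \<subseteq> I_neg \<mu> \<union> II \<mu> \<union> III \<mu> \<and> U \<subseteq> B \<inter> III \<mu> \<and>
    l \<in> labelled_boxes \<mu> B U \<rightarrow>\<^sub>E V_lines \<and>
    (\<forall>w \<in> I_neg \<mu>. BN w \<inter> B \<noteq> {} \<longrightarrow> w \<in> B) \<and>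
    (\<forall>i. \<forall>w \<in> II_bar \<mu> i.
      (\<exists>n \<in> BN w \<inter> B. \<not> (n \<in> labelled_boxes \<mu> B U \<and> l n = basis_line i)) \<longrightarrow> w \<in> B) \<and>
    (\<forall>w \<in> III \<mu>.
      (induced_span \<mu> B U l w \<noteq> {0} \<longrightarrow> w \<in> B) \<and>
      (V.dim (induced_span \<mu> B U l w) = 1 \<longrightarrow>
        w \<in> labelled_boxes \<mu> B U \<and> l w = induced_span \<mu> B U l w \<or> w \<in> U) \<and>
      (V.dim (induced_span \<mu> B U l w) = 2 \<longrightarrow> w \<in> U))"

definition labellings_space :: "(3 \<Rightarrow> nat list) \<Rightarrow> cell set \<Rightarrow> cell set \<Rightarrow> (cell \<Rightarrow> V set) topology" where
  "labellings_space \<mu> B U =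
    subtopology (product_topology (\<lambda>_. P1_topology) (labelled_boxes \<mu> B U)) {l. is_lbc \<mu> B U l}"

definition chi_top :: "(3 \<Rightarrow> nat list) \<Rightarrow> cell set \<Rightarrow> cell set \<Rightarrow> int" where
  "chi_top \<mu> B U = euler_characteristic (labellings_space \<mu> B U)"

definition lbc_families :: "(3 \<Rightarrow> nat list) \<Rightarrow> (cell set \<times> cell set) set" where
  "lbc_families \<mu> = {(B, U). \<exists>l. is_lbc \<mu> B U l}"

text \<open>The infinite sums below are unconditional sums of formal Laurent series in the \<open>q\<close>-adic
  metric; both exist, see \<open>summable_W\<close> and \<open>summable_Z_AB\<close>.\<close>

definition q_prefactor :: "(3 \<Rightarrow> nat list) \<Rightarrow> int fls" where
  "q_prefactor \<mu> = fls_X_intpow (- int (card (II \<mu>)) - 2 * int (card (III \<mu>)))"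

definition W :: "(3 \<Rightarrow> nat list) \<Rightarrow> int fls" where
  "W \<mu> = q_prefactor \<mu> *
    (\<Sum>\<^sub>\<infinity>(B, U) \<in> lbc_families \<mu>. of_int (chi_top \<mu> B U) * fls_X ^ (card B + card U))"


section \<open>AB configurations\<close>

definition is_AB :: "(3 \<Rightarrow> nat list) \<Rightarrow> cell set \<times> cell set \<Rightarrow> bool" where
  "is_AB \<mu> = (\<lambda>(A, B).
    finite A \<and> finite B \<and> A \<subseteq> I_neg \<mu> \<union> III \<mu> \<and> B \<subseteq> II \<mu> \<union> III \<mu> \<and>
    (\<forall>w \<in> I_neg \<mu> \<union> III \<mu>. BN w \<inter> A \<noteq> {} \<longrightarrow> w \<in> A) \<and>
    (\<forall>w \<in> II \<mu> \<union> III \<mu>. BN w \<inter> B \<noteq> {} \<longrightarrow> w \<in> B))"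

definition AB_base :: "(3 \<Rightarrow> nat list) \<Rightarrow> cell set \<Rightarrow> cell set \<Rightarrow> cell set \<times> cell set" where
  "AB_base \<mu> B U = (B \<inter> (I_neg \<mu> \<union> III \<mu>), (B \<inter> II \<mu>) \<union> U)"

definition P_map :: "(3 \<Rightarrow> nat list) \<Rightarrow> cell set \<times> cell set \<Rightarrow> cell set \<times> cell set" where
  "P_map \<mu> = (\<lambda>(A, B). (A \<union> (III \<mu> \<inter> (B - A)), B - (III \<mu> \<inter> (B - A))))"

definition AB_set :: "(3 \<Rightarrow> nat list) \<Rightarrow> (cell set \<times> cell set) set" where
  "AB_set \<mu> = {p. is_AB \<mu> p \<and> (\<exists>B U l. is_lbc \<mu> B U l \<and> P_map \<mu> p = AB_base \<mu> B U)}"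

definition Z_AB :: "(3 \<Rightarrow> nat list) \<Rightarrow> int fls" where
  "Z_AB \<mu> = q_prefactor \<mu> * (\<Sum>\<^sub>\<infinity>(A, B) \<in> AB_set \<mu>. fls_X ^ (card A + card B))"


section \<open>Well-definedness of the generating functions\<close>

lemma fls_summable_on:
  fixes c :: "'s \<Rightarrow> int" and wt :: "'s \<Rightarrow> nat"
  assumes fin: "\<And>n. finite {s \<in> S. wt s = n}"
  shows "(\<lambda>s. of_int (c s) * fls_X ^ wt s :: int fls) summable_on S"
proof -
  define f where "f = (\<lambda>s. of_int (c s) * fls_X ^ wt s :: int fls)"
  define F where "F = fps_to_fls (Abs_fps (\<lambda>n. \<Sum>s | s \<in> S \<and> wt s = n. c s))"
  have f_nth: "fls_nth (f s) k = (if k = int (wt s) then c s else 0)" for s k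
    by (auto simp: f_def fls_of_int)
  have "filterlim (sum f) (nhds F) (finite_subsets_at_top S)"
  proof (rule tendstoI)
    fix e :: real assume "e > 0"
    then obtain N where N: "inverse (2 ^ N) < e"
      using reals_power_lt_ex[of e 2] by (auto simp: field_simps inverse_eq_divide power_one_over)
    define T where "T = {s \<in> S. wt s < N}"
    have "T = (\<Union>n<N. {s \<in> S. wt s = n})" by (auto simp: T_def)
    then have T: "finite T" "T \<subseteq> S" using fin by (auto simp: T_def)
    have "dist (sum f X) F < e" if X: "finite X" "T \<subseteq> X" "X \<subseteq> S" for X
    proof (cases "sum f X = F")
      case False
      have "fls_nth (sum f X - F) k = 0" if k: "k < int N" for k
      proof (cases "k < 0")
        case True
        then show ?thesis by (simp add: fls_nth_sum f_nth F_def)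
      next
        case False
        then obtain n where n: "k = int n" by (metis nonneg_int_cases not_le)
        have "fls_nth (sum f X) k = (\<Sum>s\<in>X. if wt s = n then c s else 0)"
          by (simp add: fls_nth_sum f_nth n eq_commute)
        also have "\<dots> = (\<Sum>s | s \<in> X \<and> wt s = n. c s)"
          using X(1) by (simp add: sum.If_cases Int_def)
        also have "{s. s \<in> X \<and> wt s = n} = {s. s \<in> S \<and> wt s = n}"
          using X k n by (auto simp: T_def)
        finally show ?thesis by (simp add: F_def n)
      qed
      then have "int N \<le> fls_subdegree (sum f X - F)"
        using False by (intro fls_subdegree_geI) auto
      then have "N \<le> nat (fls_subdegree (sum f X - F))" "fls_subdegree (sum f X - F) \<ge> 0"
        by linarith+
      then have "dist (sum f X) F \<le> inverse (2 ^ N)"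
        using False by (simp add: dist_fls_def)
      then show ?thesis using N by linarith
    qed (use \<open>e > 0\<close> in simp)
    then show "\<forall>\<^sub>F X in finite_subsets_at_top S. dist (sum f X) F < e"
      using T unfolding eventually_finite_subsets_at_top by blast
  qed
  then show ?thesis unfolding summable_on_def has_sum_def f_def by blast
qed

lemma finite_cell_box: "finite {w :: cell. \<forall>j. w $ j \<in> {a..b}}"
proof -
  have "w = vector [w $ 1, w $ 2, w $ 3]" for w :: cell
    by (simp add: vec_eq_iff forall_3)
  then have "{w :: cell. \<forall>j. w $ j \<in> {a..b}}
      \<subseteq> (\<lambda>(x, y, z). vector [x, y, z]) ` ({a..b} \<times> {a..b} \<times> {a..b})"
    by (fastforce simp: image_iff)
  then show ?thesis by (rule finite_subset) auto
qed

lemma diagram_bounded: "\<exists>M. \<forall>(u, v) \<in> diagram p. u \<in> {0..M} \<and> v \<in> {0..M}"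
proof -
  have "u \<in> {0..int (sum_list p + length p)} \<and> v \<in> {0..int (sum_list p + length p)}"
    if "(u, v) \<in> diagram p" for u v
  proof -
    from that have "p ! nat v \<le> sum_list p"
      by (intro elem_le_sum_list) (auto simp: diagram_def)
    with that show ?thesis by (auto simp: diagram_def)
  qed
  then show ?thesis by blast
qed

lemma Cyl_bounded: "\<exists>M\<ge>0. \<forall>i. \<forall>w \<in> Cyl \<mu> i. \<forall>j. j \<noteq> i \<longrightarrow> w $ j \<in> {0..M}"
proof -
  obtain M where M: "\<And>i u v. (u, v) \<in> diagram (\<mu> i) \<Longrightarrow> u \<in> {0..M i} \<and> v \<in> {0..M i}"
    using diagram_bounded[of "\<mu> _"] by (metis (no_types, lifting) case_prodD)
  define K where "K = Max (insert 0 (range M))"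
  have le: "M i \<le> K" "0 \<le> K" for i unfolding K_def by (intro Max_ge; simp)+
  have K: "u \<in> {0..K} \<and> v \<in> {0..K}" if "(u, v) \<in> diagram (\<mu> i)" for i u v
    using M[OF that] le(1)[of i] by auto
  have "\<forall>i. \<forall>w \<in> Cyl \<mu> i. \<forall>j. j \<noteq> i \<longrightarrow> w $ j \<in> {0..K}"
    unfolding forall_3 by (auto simp: Cyl_def dest!: K)
  with le(2) show ?thesis by blast
qed

lemma Cyl_add_axis:
  assumes "w \<in> Cyl \<mu> i"
  shows "w + axis i k \<in> Cyl \<mu> i"
proof -
  have *: "i = 1 \<or> i = 2 \<or> i = 3" using exhaust_3 by blast
  have "vector [x, y, z] + axis 1 k = (vector [x + k, y, z] :: cell)"
       "vector [x, y, z] + axis 2 k = (vector [x, y + k, z] :: cell)"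
       "vector [x, y, z] + axis 3 k = (vector [x, y, z + k] :: cell)" for x y z
    by (auto simp: vec_eq_iff forall_3 axis_def)
  with assms * show ?thesis by (auto simp: Cyl_def) blast+
qed

lemma II_III_bounded:
  fixes w :: cell
  assumes "\<forall>i. \<forall>w \<in> Cyl \<mu> i. \<forall>j. j \<noteq> i \<longrightarrow> w $ j \<in> {0..M}" "w \<in> II \<mu> \<union> III \<mu>"
  shows "w $ j \<in> {0..M}"
proof -
  have "\<exists>i i'. i \<noteq> i' \<and> w \<in> Cyl \<mu> i \<and> w \<in> Cyl \<mu> i'"
  proof (cases "w \<in> III \<mu>")
    case True
    then have "w \<in> Cyl \<mu> 1" "w \<in> Cyl \<mu> 2" by (auto simp: III_def)
    moreover have "(1::3) \<noteq> 2" by simp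
    ultimately show ?thesis by blast
  next
    case False
    then obtain i where "w \<in> Cyl \<mu> (i + 1)" "w \<in> Cyl \<mu> (i + 2)"
      using assms(2) by (auto simp: II_def II_bar_def)
    moreover have "i + 1 \<noteq> i + 2" by simp
    ultimately show ?thesis by blast
  qed
  then show ?thesis using assms(1) by metis
qed

lemma finite_II_III: "finite (II \<mu>)" "finite (III \<mu>)"
proof -
  obtain M where M: "\<forall>i. \<forall>w \<in> Cyl \<mu> i. \<forall>j. j \<noteq> i \<longrightarrow> w $ j \<in> {0..M}"
    using Cyl_bounded by blast
  have "II \<mu> \<union> III \<mu> \<subseteq> {w. \<forall>j. w $ j \<in> {0..M}}"
    using II_III_bounded[OF M] by blast
  then have "finite (II \<mu> \<union> III \<mu>)" by (rule finite_subset) (rule finite_cell_box)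
  then show "finite (II \<mu>)" "finite (III \<mu>)" by auto
qed

lemma finite_small_configurations:
  "finite {S. finite S \<and> card S \<le> n \<and> S \<subseteq> I_neg \<mu> \<union> II \<mu> \<union> III \<mu> \<and>
    (\<forall>w \<in> I_neg \<mu>. BN w \<inter> S \<noteq> {} \<longrightarrow> w \<in> S)}" (is "finite ?C")
proof -
  obtain M where M0: "M \<ge> 0" and M: "\<forall>i. \<forall>w \<in> Cyl \<mu> i. \<forall>j. j \<noteq> i \<longrightarrow> w $ j \<in> {0..M}"
    using Cyl_bounded by blast
  have "w $ j \<in> {- int n..M}" if S: "S \<in> ?C" and w: "w \<in> S" for S w j
  proof (cases "w \<in> II \<mu> \<union> III \<mu>")
    case True
    then show ?thesis using II_III_bounded[OF M True, of j] by auto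
  next
    case False
    then obtain i where i: "w \<in> Cyl_neg \<mu> i" using S w by (auto simp: I_neg_def)
    then have wC: "w \<in> Cyl \<mu> i" and neg: "w $ i < 0"
      using M by (auto simp: Cyl_neg_def not_le) (metis atLeastAtMost_iff not_le)
    define m where "m = nat (- w $ i)"
    have m: "int m = - w $ i" using neg by (simp add: m_def)
    have in_S: "k < m \<Longrightarrow> w + axis i (int k) \<in> S" for k
    proof (induction k)
      case 0
      have "w + axis i 0 = w" by (simp add: vec_eq_iff axis_def)
      then show ?case using w by (simp only: of_nat_0)
    next
      case (Suc k)
      let ?w = "w + axis i (int (Suc k))"
      have "?w $ i < 0" using Suc.prems m by (simp add: axis_def)
      then have "\<not> (\<forall>j. 0 \<le> ?w $ j)" by (meson not_le)
      then have "?w \<in> I_neg \<mu>"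
        using Cyl_add_axis[OF wC] unfolding I_neg_def Cyl_neg_def by blast
      have "?w - axis i 1 = w + axis i (int k)"
        by (auto simp: vec_eq_iff axis_def)
      moreover have "?w - axis i 1 \<in> BN ?w"
        using exhaust_3[of i] by (auto simp: BN_def)
      ultimately have "w + axis i (int k) \<in> BN ?w" by metis
      moreover have "w + axis i (int k) \<in> S" using Suc by simp
      ultimately show ?case using S \<open>?w \<in> I_neg \<mu>\<close> by blast
    qed
    have "inj_on (\<lambda>k. w + axis i (int k)) {..<m}"
      by (auto simp: inj_on_def vec_eq_iff axis_def split: if_splits)
    then have "m \<le> card S"
      using card_inj_on_le[of "\<lambda>k. w + axis i (int k)" "{..<m}" S] in_S S by auto
    then have "- int n \<le> w $ i" using S m by auto
    then show ?thesis
      using M wC neg M0 by (cases "j = i") force+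
  qed
  then have "?C \<subseteq> Pow {w. \<forall>j. w $ j \<in> {- int n..M}}" by blast
  then show ?thesis by (rule finite_subset) (simp only: finite_Pow_iff finite_cell_box)
qed

lemma summable_W:
  "(\<lambda>(B, U). of_int (chi_top \<mu> B U) * fls_X ^ (card B + card U) :: int fls)
    summable_on lbc_families \<mu>"
proof -
  let ?C = "\<lambda>n. {S. finite S \<and> card S \<le> n \<and> S \<subseteq> I_neg \<mu> \<union> II \<mu> \<union> III \<mu> \<and>
    (\<forall>w \<in> I_neg \<mu>. BN w \<inter> S \<noteq> {} \<longrightarrow> w \<in> S)}"
  have "finite {s \<in> lbc_families \<mu>. card (fst s) + card (snd s) = n}" for n
  proof (rule finite_subset)
    show "{s \<in> lbc_families \<mu>. card (fst s) + card (snd s) = n} \<subseteq> ?C n \<times> Pow (III \<mu>)"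
      by (auto simp: lbc_families_def is_lbc_def)
    show "finite (?C n \<times> Pow (III \<mu>))"
      using finite_small_configurations finite_II_III by blast
  qed
  from fls_summable_on[OF this, of "\<lambda>s. chi_top \<mu> (fst s) (snd s)"]
  show ?thesis by (simp add: case_prod_unfold)
qed

lemma summable_Z_AB:
  "(\<lambda>(A, B). fls_X ^ (card A + card B) :: int fls) summable_on AB_set \<mu>"
proof -
  let ?C = "\<lambda>n. {S. finite S \<and> card S \<le> n \<and> S \<subseteq> I_neg \<mu> \<union> II \<mu> \<union> III \<mu> \<and>
    (\<forall>w \<in> I_neg \<mu>. BN w \<inter> S \<noteq> {} \<longrightarrow> w \<in> S)}"
  have "finite {s \<in> AB_set \<mu>. card (fst s) + card (snd s) = n}" for n
  proof (rule finite_subset)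
    show "{s \<in> AB_set \<mu>. card (fst s) + card (snd s) = n} \<subseteq> ?C n \<times> Pow (II \<mu> \<union> III \<mu>)"
      by (auto simp: AB_set_def is_AB_def)
    show "finite (?C n \<times> Pow (II \<mu> \<union> III \<mu>))"
      using finite_small_configurations finite_II_III by blast
  qed
  from fls_summable_on[OF this, of "\<lambda>_. 1"]
  show ?thesis by (simp add: case_prod_unfold)
qed

end

theory Submission
  imports Defs
begin

text \<open>
  Fix the boxes \<open>B\<close> and the unlabelled boxes \<open>U\<close>. Two adjacent labelled boxes carry the same label, and
  a labelled box next to a box of type \<open>I\<^sup>-\<close> or to a missing box of type \<open>II\<close> has a prescribed label;
  the remaining conditions do not involve the labels. Hence the space of labellings is a product of
  copies of the projective line, one for each connected component of labelled boxes without a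
  prescribed label, and its Euler characteristic is \<open>2 ^ k\<close> for \<open>k\<close> such components. On the other side,
  an AB configuration \<open>(A, B')\<close> with \<open>P(A, B') = AB_base(B, U)\<close> is determined by the set \<open>III \<inter> (B' - A)\<close>,
  which can be any union of such components, so there are again \<open>2 ^ k\<close> of them, all of weight
  \<open>card B + card U\<close>.

  The Betti numbers follow from \<open>H\<^sub>p(X \<times> P\<^sup>1) \<cong> H\<^sub>p(X) \<times> H\<^sub>p\<^sub>-\<^sub>2(X)\<close>: the projective line is covered by two
  affine lines, their intersection \<open>\<complex> - {0}\<close> by two slit planes, and the intersection of those,
  \<open>\<complex> - \<real>\<close>, is the disjoint union of two half planes; each cover lowers the degree of
  \<open>H\<^sub>p(X \<times> Y, X \<times> pt)\<close> by one through excision and the exact sequence of a triple.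
\<close>

section \<open>Rank of finitely generated free abelian groups\<close>

text \<open>Gaussian elimination without division, by induction on the number of columns: if some
  row \<open>k\<close> has a nonzero entry in column \<open>n\<close>, cross-multiplying with it
  clears that column in every other row, and the induction hypothesis applies to the remaining
  \<open>card I - 1\<close> rows.\<close>

lemma int_linear_relation_exists:
  fixes f :: "'i \<Rightarrow> nat \<Rightarrow> int"
  assumes "finite I" "n < card I"
  shows "\<exists>c. (\<exists>i\<in>I. c i \<noteq> 0) \<and> (\<forall>j<n. (\<Sum>i\<in>I. c i * f i j) = 0)"
  using assms
proof (induction n arbitrary: I f)
  case 0
  then have "I \<noteq> {}" by auto
  then show ?case by (auto intro!: exI[of _ "\<lambda>_. 1"])
next
  case (Suc n)
  show ?case
  proof (cases "\<forall>i\<in>I. f i n = 0")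
    case True
    from Suc.IH[of I f] Suc.prems
    obtain c where "\<exists>i\<in>I. c i \<noteq> 0" "\<forall>j<n. (\<Sum>i\<in>I. c i * f i j) = 0" by auto
    with True show ?thesis by (auto simp: less_Suc_eq intro!: exI[of _ c])
  next
    case False
    then obtain k where k: "k \<in> I" "f k n \<noteq> 0" by blast
    let ?J = "I - {k}" and ?g = "\<lambda>i j. f k n * f i j - f i n * f k j"
    have "n < card ?J" using Suc.prems k by simp
    from Suc.IH[of ?J ?g] this Suc.prems
    obtain c where c: "\<exists>i\<in>?J. c i \<noteq> 0" "\<And>j. j < n \<Longrightarrow> (\<Sum>i\<in>?J. c i * ?g i j) = 0" by auto
    \<comment> \<open>A relation \<open>c\<close> among the cleared rows becomes one among the
      original rows: each \<open>c i\<close> is scaled by the pivot \<open>f k n\<close>, and the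
      pivot row collects the subtracted multiples. Column \<open>n\<close> then cancels
      automatically.\<close>
    define d where "d i = (if i = k then - (\<Sum>i\<in>?J. c i * f i n) else c i * f k n)" for i
    have "(\<Sum>i\<in>I. d i * f i j) = (\<Sum>i\<in>?J. c i * ?g i j)" for j
    proof -
      have "(\<Sum>i\<in>I. d i * f i j) = d k * f k j + (\<Sum>i\<in>?J. d i * f i j)"
        using Suc.prems k by (simp add: sum.remove)
      also have "(\<Sum>i\<in>?J. d i * f i j) = (\<Sum>i\<in>?J. c i * f k n * f i j)"
        by (intro sum.cong) (auto simp: d_def)
      also have "d k * f k j = (\<Sum>i\<in>?J. - (c i * f i n * f k j))"
        by (simp add: d_def sum_distrib_right sum_negf)
      finally show ?thesis by (simp add: sum.distrib[symmetric] algebra_simps)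
    qed
    moreover have "(\<Sum>i\<in>?J. c i * ?g i n) = 0" by (simp add: mult.commute)
    ultimately have "\<forall>j<Suc n. (\<Sum>i\<in>I. d i * f i j) = 0" using c(2) by (auto simp: less_Suc_eq)
    moreover from c(1) k have "\<exists>i\<in>I. d i \<noteq> 0" by (auto simp: d_def)
    ultimately show ?thesis by blast
  qed
qed

text \<open>A model of the free abelian group of rank \<open>n\<close>. Sequences vanishing from
  index \<open>n\<close> on give all ranks the same carrier type, so the rank can vary in an
  induction.\<close>

definition int_lattice :: "nat \<Rightarrow> (nat \<Rightarrow> int) monoid" where
  "int_lattice n = \<lparr>carrier = {f. \<forall>j\<ge>n. f j = 0}, mult = (\<lambda>f g j. f j + g j), one = (\<lambda>_. 0)\<rparr>"

lemma int_lattice_simps [simp]: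
  "carrier (int_lattice n) = {f. \<forall>j\<ge>n. f j = 0}"
  "f \<otimes>\<^bsub>int_lattice n\<^esub> g = (\<lambda>j. f j + g j)"
  "\<one>\<^bsub>int_lattice n\<^esub> = (\<lambda>_. 0)"
  by (auto simp: int_lattice_def)

lemma comm_group_int_lattice: "comm_group (int_lattice n)"
proof (rule comm_groupI)
  fix f assume "f \<in> carrier (int_lattice n)"
  then show "\<exists>g\<in>carrier (int_lattice n). g \<otimes>\<^bsub>int_lattice n\<^esub> f = \<one>\<^bsub>int_lattice n\<^esub>"
    by (intro bexI[of _ "\<lambda>j. - f j"]) auto
qed (auto simp: algebra_simps)

lemma int_lattice_pow:
  assumes "f \<in> carrier (int_lattice n)"
  shows "f [^]\<^bsub>int_lattice n\<^esub> (k::int) = (\<lambda>j. k * f j)"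
proof -
  interpret comm_group "int_lattice n" by (rule comm_group_int_lattice)
  have nat: "f [^]\<^bsub>int_lattice n\<^esub> (m::nat) = (\<lambda>j. int m * f j)" for m
    by (induction m) (auto simp: algebra_simps)
  have inv: "inv\<^bsub>int_lattice n\<^esub> g = (\<lambda>j. - g j)" if "g \<in> carrier (int_lattice n)" for g
    using that by (intro inv_equality) auto
  show ?thesis
    using assms by (cases "k \<ge> 0") (auto simp: int_pow_def2 nat inv)
qed

lemma int_lattice_finprod:
  assumes "finite S" "\<And>x. x \<in> S \<Longrightarrow> g x \<in> carrier (int_lattice n)"
  shows "finprod (int_lattice n) g S = (\<lambda>j. \<Sum>x\<in>S. g x j)"
proof -
  interpret comm_group "int_lattice n" by (rule comm_group_int_lattice)
  show ?thesis using assms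
  proof (induction S)
    case (insert x S)
    then show ?case by (subst finprod_insert) auto
  qed simp
qed

lemma int_independent_int_lattice_iff:
  "int_independent (int_lattice n) S \<longleftrightarrow> finite S \<and> S \<subseteq> carrier (int_lattice n) \<and>
    (\<forall>c. (\<forall>j<n. (\<Sum>x\<in>S. c x * x j) = 0) \<longrightarrow> (\<forall>x\<in>S. c x = 0))"
proof -
  have "finprod (int_lattice n) (\<lambda>x. x [^]\<^bsub>int_lattice n\<^esub> c x) S = \<one>\<^bsub>int_lattice n\<^esub> \<longleftrightarrow>
      (\<forall>j<n. (\<Sum>x\<in>S. c x * x j) = 0)" if S: "finite S" "S \<subseteq> carrier (int_lattice n)" for c
  proof -
    have "finprod (int_lattice n) (\<lambda>x. x [^]\<^bsub>int_lattice n\<^esub> c x) S = (\<lambda>j. \<Sum>x\<in>S. (x [^]\<^bsub>int_lattice n\<^esub> c x) j)"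
      using S by (intro int_lattice_finprod) (auto simp: int_lattice_pow)
    also have "\<dots> = (\<lambda>j. \<Sum>x\<in>S. c x * x j)"
      using S by (intro ext sum.cong) (auto simp: int_lattice_pow)
    finally have *: "finprod (int_lattice n) (\<lambda>x. x [^]\<^bsub>int_lattice n\<^esub> c x) S = (\<lambda>j. \<Sum>x\<in>S. c x * x j)" .
    have "(\<Sum>x\<in>S. c x * x j) = 0" if "j \<ge> n" for j
      using S that by (intro sum.neutral) auto
    then show ?thesis unfolding * by (auto simp: fun_eq_iff) (meson not_le)
  qed
  then show ?thesis unfolding int_independent_def by blast
qed

text \<open>More than \<open>n\<close> vectors are dependent by
  \<open>int_linear_relation_exists\<close>, and the unit vectors \<open>?e i\<close> attain the
  bound.\<close>

lemma abelian_rank_int_lattice: "abelian_rank (int_lattice n) = n"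
proof -
  have "card S \<le> n" if S: "int_independent (int_lattice n) S" for S
  proof (rule ccontr)
    assume "\<not> card S \<le> n"
    then obtain c where "\<exists>i\<in>S. c i \<noteq> 0" "\<forall>j<n. (\<Sum>i\<in>S. c i * i j) = 0"
      using int_linear_relation_exists[of S n "\<lambda>x. x"] S
      by (auto simp: int_independent_int_lattice_iff)
    then show False using S unfolding int_independent_int_lattice_iff by blast
  qed
  moreover have "\<exists>S. int_independent (int_lattice n) S \<and> card S = n"
  proof -
    let ?e = "\<lambda>i j. if i = j then 1 else 0 :: int"
    have inj: "inj_on ?e {..<n}" by (auto simp: inj_on_def fun_eq_iff split: if_splits) 
    have "int_independent (int_lattice n) (?e ` {..<n})"
      unfolding int_independent_int_lattice_iff
    proof (intro conjI allI impI ballI)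
      fix c x assume c: "\<forall>j<n. (\<Sum>x\<in>?e ` {..<n}. c x * x j) = 0" and "x \<in> ?e ` {..<n}"
      then obtain j where j: "j < n" "x = ?e j" by blast
      have "(\<Sum>x\<in>?e ` {..<n}. c x * x j) = (\<Sum>i<n. c (?e i) * ?e i j)"
        by (simp add: sum.reindex[OF inj])
      also have "\<dots> = (\<Sum>i<n. if i = j then c (?e i) else 0)" by (intro sum.cong) auto
      also have "\<dots> = c x" using j by simp
      finally show "c x = 0" using c j(1) by simp
    qed auto
    then show ?thesis using card_image[OF inj] by (metis card_lessThan)
  qed
  ultimately show ?thesis
    unfolding abelian_rank_def by (intro cSup_eq_maximum) auto
qed

text \<open>A relation with coefficients \<open>c\<close> among the images pulls back, by
  injectivity of \<open>h\<close>, to the relation with coefficients \<open>c (h x)\<close> among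
  the elements of \<open>S\<close>.\<close>

lemma int_independent_iso_image:
  assumes "comm_group G" "comm_group H" "h \<in> iso G H" "int_independent G S"
  shows "int_independent H (h ` S) \<and> card (h ` S) = card S"
proof -
  interpret G: comm_group G by fact
  interpret H: comm_group H by fact
  have h: "h \<in> hom G H" "inj_on h (carrier G)" using assms(3) by (auto simp: iso_def bij_betw_def)
  then interpret group_hom G H h by unfold_locales
  have S: "finite S" "S \<subseteq> carrier G" using assms(4) by (auto simp: int_independent_def)
  have inj: "inj_on h S" using h S by (meson inj_on_subset)
  have "c (h x) = 0" if c: "finprod H (\<lambda>y. y [^]\<^bsub>H\<^esub> c y) (h ` S) = \<one>\<^bsub>H\<^esub>" and x: "x \<in> S" for c :: "_ \<Rightarrow> int" and x
  proof -
    have mem: "(\<lambda>x. x [^]\<^bsub>G\<^esub> c (h x)) \<in> S \<rightarrow> carrier G" using S by auto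
    have "finprod H (\<lambda>y. y [^]\<^bsub>H\<^esub> c y) (h ` S) = finprod H (\<lambda>x. h x [^]\<^bsub>H\<^esub> c (h x)) S"
      using S inj h by (intro H.finprod_reindex) (auto simp: hom_def)
    also have "\<dots> = finprod H (\<lambda>x. h (x [^]\<^bsub>G\<^esub> c (h x))) S"
      using S by (intro H.finprod_cong) (auto simp: hom_int_pow subset_iff)
    also have "\<dots> = h (finprod G (\<lambda>x. x [^]\<^bsub>G\<^esub> c (h x)) S)"
      using S(1) mem
    proof (induction S)
      case (insert y T)
      then show ?case
        by (auto simp: Pi_iff)
    qed simp
    finally have "h (finprod G (\<lambda>x. x [^]\<^bsub>G\<^esub> c (h x)) S) = h \<one>\<^bsub>G\<^esub>" using c by simp
    then have "finprod G (\<lambda>x. x [^]\<^bsub>G\<^esub> c (h x)) S = \<one>\<^bsub>G\<^esub>"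
      using inj_onD[OF h(2)] G.finprod_closed[OF mem] G.one_closed by blast
    then show ?thesis using assms(4) x unfolding int_independent_def by (metis (no_types))
  qed
  then show ?thesis
    using S inj h by (auto simp: int_independent_def card_image hom_def)
qed

lemma abelian_rank_iso:
  assumes "comm_group G" "comm_group H" "G \<cong> H"
  shows "abelian_rank G = abelian_rank H"
proof -
  \<comment> \<open>Stated for groups over arbitrary types, so that it can be applied to the
    isomorphism and to its inverse.\<close>
  have sub: "card ` {S. int_independent G S} \<subseteq> card ` {S. int_independent H S}"
    if GH: "comm_group G" "comm_group H" "G \<cong> H"
    for G :: "('x, 'y) monoid_scheme" and H :: "('z, 'w) monoid_scheme"
  proof -
    obtain h where "h \<in> iso G H" using GH(3) by (auto simp: is_iso_def)
    from int_independent_iso_image[OF GH(1,2) this] show ?thesis by (force simp: image_iff)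
  qed
  have "H \<cong> G" using assms by (simp add: group.iso_sym comm_group_def)
  from sub[OF assms] sub[OF assms(2,1) this] show ?thesis
    unfolding abelian_rank_def by (metis subset_antisym)
qed

lemma int_lattice_prod: "int_lattice m \<times>\<times> int_lattice n \<cong> int_lattice (m + n)"
proof -
  let ?h = "\<lambda>(f, g) j. if j < m then f j else g (j - m)"
  have "?h \<in> iso (int_lattice m \<times>\<times> int_lattice n) (int_lattice (m + n))"
  proof (rule isoI)
    show "?h \<in> hom (int_lattice m \<times>\<times> int_lattice n) (int_lattice (m + n))"
      by (auto simp: hom_def mult_DirProd')
    show "bij_betw ?h (carrier (int_lattice m \<times>\<times> int_lattice n)) (carrier (int_lattice (m + n)))"
      by (rule bij_betw_byWitness[where f' = "\<lambda>h. (\<lambda>j. if j < m then h j else 0, \<lambda>j. h (j + m))"])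
        (auto simp: fun_eq_iff)
  qed
  then show ?thesis by (rule is_isoI)
qed

lemma integer_group_iso_int_lattice: "integer_group \<cong> int_lattice 1"
proof -
  have "(\<lambda>k j. if j = 0 then k else 0) \<in> iso integer_group (int_lattice 1)"
  proof (rule isoI)
    show "bij_betw (\<lambda>k j. if j = 0 then k else 0) (carrier integer_group) (carrier (int_lattice 1))"
      by (rule bij_betw_byWitness[where f' = "\<lambda>h. h 0"]) (auto simp: fun_eq_iff)
  qed (auto simp: hom_def)
  then show ?thesis by (rule is_isoI)
qed

lemma trivial_group_iso_int_lattice:
  assumes "trivial_group G"
  shows "G \<cong> int_lattice 0"
proof -
  have G: "group G" "carrier G = {\<one>\<^bsub>G\<^esub>}" using assms by (auto simp: trivial_group_def)
  have "(\<lambda>_ _. 0) \<in> iso G (int_lattice 0)"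
    by (rule isoI) (auto simp: hom_def bij_betw_def G(2))
  then show ?thesis by (rule is_isoI)
qed

section \<open>Homology of products with a covered space\<close>

text \<open>In the exact sequence of the triple \<open>T\<close>, \<open>S\<close>, \<open>X\<close>
  the groups of the pair \<open>(S, T)\<close> on both sides of the map vanish.\<close>

lemma iso_relative_homology_enlarge_subspace:
  assumes "T \<subseteq> S" and triv: "\<And>p. trivial_group (relative_homology_group p (subtopology X S) T)"
  shows "relative_homology_group p X T \<cong> relative_homology_group p X S"
proof -
  have "hom_induced p X T X S id \<in> iso (relative_homology_group p X T) (relative_homology_group p X S)"
  proof (rule very_short_exact_sequence)
    show "exact_seq ([relative_homology_group (p-1) (subtopology X S) T, relative_homology_group p X S,
           relative_homology_group p X T, relative_homology_group p (subtopology X S) T],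
           [hom_relboundary p X S T, hom_induced p X T X S id, hom_induced p (subtopology X S) T X T id])"
      using homology_exactness_triple_1[OF assms(1), of p X] homology_exactness_triple_3[OF assms(1), of p X]
      by simp
  qed (use triv in auto)
  then show ?thesis by (rule is_isoI)
qed

text \<open>The same exact sequence of a triple, now with vanishing groups of the pair
  \<open>(X, T)\<close>; the connecting map becomes an isomorphism and lowers the degree by
  one.\<close>

lemma iso_relative_homology_relboundary:
  assumes "T \<subseteq> S" and triv: "\<And>p. trivial_group (relative_homology_group p X T)"
  shows "relative_homology_group p X S \<cong> relative_homology_group (p - 1) (subtopology X S) T"
proof -
  have "hom_relboundary p X S T
        \<in> iso (relative_homology_group p X S) (relative_homology_group (p - 1) (subtopology X S) T)"
  proof (rule very_short_exact_sequence)
    show "exact_seq ([relative_homology_group (p-1) X T, relative_homology_group (p-1) (subtopology X S) T,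
           relative_homology_group p X S, relative_homology_group p X T],
           [hom_induced (p-1) (subtopology X S) T X T id, hom_relboundary p X S T, hom_induced p X T X S id])"
      using homology_exactness_triple_1[OF assms(1), of p X] homology_exactness_triple_2[OF assms(1), of p X]
      by simp
  qed (use triv in auto)
  then show ?thesis by (rule is_isoI)
qed

text \<open>Excision of the complement of \<open>U\<close>, which is closed and contained in the
  open set \<open>V\<close>.\<close>

lemma iso_relative_homology_excision_cover:
  assumes "openin Z U" "openin Z V" "U \<union> V = topspace Z"
  shows "relative_homology_group p Z V \<cong> relative_homology_group p (subtopology Z U) (U \<inter> V)"
proof -
  have "Z closure_of (topspace Z - U) \<subseteq> Z interior_of V"
  proof -
    have "closedin Z (topspace Z - U)" using assms(1) by blast
    then have "Z closure_of (topspace Z - U) = topspace Z - U" by (rule closure_of_closedin)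
    then show ?thesis using assms by (auto simp: interior_of_openin)
  qed
  from homology_excision_axiom[OF this, of "topspace Z" p]
  have "relative_homology_group p (subtopology Z (topspace Z - (topspace Z - U))) (V - (topspace Z - U))
        \<cong> relative_homology_group p Z V"
    using assms by (auto intro: is_isoI dest: openin_subset)
  moreover have "topspace Z - (topspace Z - U) = U" "V - (topspace Z - U) = U \<inter> V"
    using assms by (auto dest: openin_subset)
  ultimately show ?thesis by (simp add: group.iso_sym)
qed

text \<open>Contracting \<open>Y\<close> to \<open>d\<close> in the second factor gives a homotopy
  from the identity to the projection \<open>?f\<close> onto the slice over \<open>d\<close>, and
  \<open>?f\<close> is the identity on that slice.\<close>

lemma trivial_relative_homology_prod_contractible:
  assumes "contractible_space Y" "d \<in> topspace Y"
  shows "trivial_group (relative_homology_group p (prod_topology X Y) (topspace X \<times> {d}))"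
proof (rule trivial_relative_homology_group_gen)
  let ?f = "\<lambda>z. (fst z, d)"
  have eq: "subtopology (prod_topology X Y) (topspace X \<times> {d}) = prod_topology X (subtopology Y {d})"
    by (simp add: prod_topology_subtopology)
  show "continuous_map (prod_topology X Y) (subtopology (prod_topology X Y) (topspace X \<times> {d})) ?f"
    using assms(2) by (auto simp: continuous_map_in_subtopology continuous_map_pairwise o_def continuous_map_fst)
  have "homotopic_with (\<lambda>h. True) (prod_topology X Y) (prod_topology X Y)
      (\<lambda>z. (id (fst z), id (snd z))) (\<lambda>z. (id (fst z), (\<lambda>x. d) (snd z)))"
    using assms by (intro homotopic_with_prod_topology[of "\<lambda>_. True" _ _ _ _ "\<lambda>_. True"])
      (auto simp: contractible_space_alt simp del: id_apply)
  then show "homotopic_with (\<lambda>h. True) (prod_topology X Y) (prod_topology X Y) ?f id"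
    by (simp add: homotopic_with_sym id_def)
  show "homotopic_with (\<lambda>h. True) (subtopology (prod_topology X Y) (topspace X \<times> {d}))
      (subtopology (prod_topology X Y) (topspace X \<times> {d})) ?f id"
    unfolding eq
  proof (rule homotopic_with_equal)
    show "continuous_map (prod_topology X (subtopology Y {d})) (prod_topology X (subtopology Y {d})) ?f"
      using assms(2) by (auto simp: continuous_map_pairwise o_def continuous_map_fst)
  qed auto
qed

lemma subtopology_prod_Times_right:
  "subtopology (prod_topology X Y) (topspace X \<times> S) = prod_topology X (subtopology Y S)"
  by (simp add: prod_topology_subtopology)

text \<open>Contractibility of \<open>V\<close> allows the slice over \<open>c\<close> to be
  enlarged to the product with \<open>V\<close>; then the complement of \<open>U\<close> is
  excised.\<close>

lemma iso_relative_homology_prod_cover: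
  assumes UV: "openin Y U" "openin Y V" "U \<union> V = topspace Y"
    and V: "contractible_space (subtopology Y V)" "c \<in> V"
  shows "relative_homology_group p (prod_topology X Y) (topspace X \<times> {c})
       \<cong> relative_homology_group p (prod_topology X (subtopology Y U)) (topspace X \<times> (U \<inter> V))"
proof -
  let ?Z = "prod_topology X Y"
  have sub: "U \<subseteq> topspace Y" "V \<subseteq> topspace Y" using UV by (auto dest: openin_subset)
  have "relative_homology_group p ?Z (topspace X \<times> {c}) \<cong> relative_homology_group p ?Z (topspace X \<times> V)"
  proof (rule iso_relative_homology_enlarge_subspace)
    show "trivial_group (relative_homology_group p (subtopology ?Z (topspace X \<times> V)) (topspace X \<times> {c}))" for p
      unfolding subtopology_prod_Times_right
      using V sub by (intro trivial_relative_homology_prod_contractible) auto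
  qed (use V in auto)
  also have "\<dots> \<cong> relative_homology_group p (subtopology ?Z (topspace X \<times> U))
      ((topspace X \<times> U) \<inter> (topspace X \<times> V))"
    using UV by (intro iso_relative_homology_excision_cover) (auto simp: openin_prod_Times_iff)
  finally show ?thesis
    unfolding subtopology_prod_Times_right by (simp add: Times_Int_Times)
qed

text \<open>When \<open>U\<close> is contractible as well, \<open>Y\<close> behaves like a
  suspension of \<open>U \<inter> V\<close>: after the excision, the connecting map of the triple
  given by \<open>{d}\<close>, \<open>U \<inter> V\<close> and \<open>U\<close> (each times
  \<open>X\<close>) is an isomorphism.\<close>

lemma iso_relative_homology_prod_suspension:
  assumes UV: "openin Y U" "openin Y V" "U \<union> V = topspace Y"
    and V: "contractible_space (subtopology Y V)" "c \<in> V"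
    and U: "contractible_space (subtopology Y U)" and d: "d \<in> U \<inter> V"
  shows "relative_homology_group p (prod_topology X Y) (topspace X \<times> {c})
       \<cong> relative_homology_group (p - 1) (prod_topology X (subtopology Y (U \<inter> V))) (topspace X \<times> {d})"
proof -
  have sub: "U \<subseteq> topspace Y" using UV by (auto dest: openin_subset)
  note iso_relative_homology_prod_cover[OF UV V, of p X]
  also have "relative_homology_group p (prod_topology X (subtopology Y U)) (topspace X \<times> (U \<inter> V))
      \<cong> relative_homology_group (p - 1)
          (subtopology (prod_topology X (subtopology Y U)) (topspace X \<times> (U \<inter> V))) (topspace X \<times> {d})"
  proof (rule iso_relative_homology_relboundary)
    show "trivial_group (relative_homology_group p (prod_topology X (subtopology Y U)) (topspace X \<times> {d}))" for p
      using U d sub by (intro trivial_relative_homology_prod_contractible) auto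
  qed (use d in auto)
  finally show ?thesis
    unfolding subtopology_prod_Times_right by (simp add: subtopology_subtopology)
qed

lemma homotopy_equivalent_space_prod_contractible:
  assumes "contractible_space Y" "topspace Y \<noteq> {}"
  shows "prod_topology X Y homotopy_equivalent_space X"
proof -
  obtain d where d: "d \<in> topspace Y" using assms by blast
  have "homotopic_with (\<lambda>h. True) (prod_topology X Y) (prod_topology X Y)
      (\<lambda>z. (id (fst z), id (snd z))) (\<lambda>z. (id (fst z), (\<lambda>x. d) (snd z)))"
    using assms d by (intro homotopic_with_prod_topology[of "\<lambda>_. True" _ _ _ _ "\<lambda>_. True"])
      (auto simp: contractible_space_alt simp del: id_apply)
  then have "homotopic_with (\<lambda>h. True) (prod_topology X Y) (prod_topology X Y) ((\<lambda>x. (x, d)) \<circ> fst) id"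
    by (simp add: homotopic_with_sym id_def o_def)
  moreover have "homotopic_with (\<lambda>h. True) X X (fst \<circ> (\<lambda>x. (x, d))) id"
    by (simp add: o_def id_def)
  moreover have "continuous_map X (prod_topology X Y) (\<lambda>x. (x, d))"
    using d by (simp add: continuous_map_pairwise o_def)
  ultimately show ?thesis
    unfolding homotopy_equivalent_space_def using continuous_map_fst by blast
qed

text \<open>Up to homotopy \<open>Y\<close> consists of two points. The point at \<open>c\<close> is
  killed by passing to the relative group, and the other one contributes a copy of the homology of
  \<open>X\<close>.\<close>

lemma iso_relative_homology_prod_two_points:
  assumes UV: "openin Y U" "openin Y V" "U \<union> V = topspace Y" "U \<inter> V = {}"
    and V: "contractible_space (subtopology Y V)" "c \<in> V"
    and U: "contractible_space (subtopology Y U)" "U \<noteq> {}"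
  shows "relative_homology_group p (prod_topology X Y) (topspace X \<times> {c}) \<cong> homology_group p X"
proof -
  note iso_relative_homology_prod_cover[OF UV(1-3) V, of p X]
  \<comment> \<open>The homology of a pair with empty subspace is by definition absolute
    homology.\<close>
  also have "topspace X \<times> (U \<inter> V) = {}" using UV by simp
  also have "homology_group p (prod_topology X (subtopology Y U)) \<cong> homology_group p X"
  proof (intro homotopy_equivalent_space_imp_isomorphic_homology_groups
      homotopy_equivalent_space_prod_contractible)
    show "topspace (subtopology Y U) \<noteq> {}"
      using U UV openin_subset[OF UV(1)] by auto
  qed (use U in simp)
  finally show ?thesis .
qed

lemma iso_relative_homology_prod_homeomorphic:
  assumes "homeomorphic_map Y Y' h" "c \<in> topspace Y"
  shows "relative_homology_group p (prod_topology X Y) (topspace X \<times> {c})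
       \<cong> relative_homology_group p (prod_topology X Y') (topspace X \<times> {h c})"
proof -
  have "homeomorphic_map (prod_topology X Y) (prod_topology X Y') (\<lambda>(x, y). (id x, h y))"
    using assms(1) homeomorphic_maps_id[of X]
    unfolding homeomorphic_map_maps by (metis homeomorphic_maps_prod)
  moreover have "topspace X \<times> {c} \<subseteq> topspace (prod_topology X Y)" using assms(2) by auto
  moreover have "(\<lambda>(x, y). (id x, h y)) ` (topspace X \<times> {c}) = topspace X \<times> {h c}" by force
  ultimately show ?thesis by (rule is_isoI[OF homeomorphic_map_relative_homology_iso])
qed

text \<open>The slice over \<open>c\<close> is a retract of the product, so the long exact sequence
  of the pair splits; the slice itself is a copy of \<open>X\<close>.\<close>

lemma iso_homology_prod_split:
  assumes "c \<in> topspace Y"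
  shows "homology_group p (prod_topology X Y)
       \<cong> homology_group p X \<times>\<times> relative_homology_group p (prod_topology X Y) (topspace X \<times> {c})"
proof -
  let ?Z = "prod_topology X Y" and ?S = "topspace X \<times> {c}"
  have "?S retract_of_space ?Z"
    unfolding retract_of_space_def
    using assms by (auto intro!: exI[of _ "\<lambda>z. (fst z, c)"]
      simp: continuous_map_in_subtopology continuous_map_pairwise o_def continuous_map_fst)
  then have "homology_group p ?Z \<cong> homology_group p (subtopology ?Z ?S) \<times>\<times> relative_homology_group p ?Z ?S"
    by (intro isomorphic_group_homology_group_prod_retract) simp
  moreover have "homology_group p (subtopology ?Z ?S) \<cong> homology_group p X"
    unfolding subtopology_prod_Times_right using assms
    by (intro homotopy_equivalent_space_imp_isomorphic_homology_groups
      homotopy_equivalent_space_prod_contractible) auto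
  ultimately show ?thesis
    by (meson group.DirProd_iso_trans iso_trans iso_refl group_relative_homology_group)
qed

section \<open>The projective line\<close>

lemma iso_relative_homology_prod_punctured_plane:
  "relative_homology_group p (prod_topology X (top_of_set (- {0::complex}))) (topspace X \<times> {1})
     \<cong> homology_group (p - 1) X"
proof -
  let ?Y = "top_of_set (- {0::complex})" and ?Y' = "top_of_set {z::complex. Im z \<noteq> 0}"
  \<comment> \<open>The plane slit along the nonpositive reals contains the base point
    \<open>1\<close>. The new base point \<open>\<i>\<close> lies in both slit planes, and in the
    upper half plane \<open>?V'\<close> used below.\<close>
  let ?V = "- (complex_of_real ` {..0})" and ?U = "- (complex_of_real ` {0..})"
  note slots = complex_slot_left_eq complex_slot_right_eq
  have UV: "?U \<inter> ?V = {z. Im z \<noteq> 0}" "?U \<union> ?V = - {0}"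
    by (auto simp: slots complex_eq_iff)
  have "openin ?Y ?U" "openin ?Y ?V"
    using UV(2) closed_slot_left[of 0] closed_slot_right[of 0]
    by (intro open_subset; auto simp: open_Compl)+
  moreover have "contractible_space (subtopology ?Y ?U)" "contractible_space (subtopology ?Y ?V)"
    using UV(2) starlike_imp_contractible[OF starlike_slotted_complex_plane_left[of 0]]
      starlike_imp_contractible[OF starlike_slotted_complex_plane_right[of 0]]
    by (simp_all add: subtopology_subtopology Int_absorb1 flip: UV(2))
  ultimately have "relative_homology_group p (prod_topology X ?Y) (topspace X \<times> {1})
     \<cong> relative_homology_group (p - 1) (prod_topology X (subtopology ?Y (?U \<inter> ?V))) (topspace X \<times> {\<i>})"
    using UV by (intro iso_relative_homology_prod_suspension) (auto simp: slots)
  also have "subtopology ?Y (?U \<inter> ?V) = ?Y'"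
    unfolding UV(1) subtopology_subtopology by (rule arg_cong[of _ _ top_of_set]) auto
  also have "relative_homology_group (p - 1) (prod_topology X ?Y') (topspace X \<times> {\<i>}) \<cong> homology_group (p - 1) X"
  proof (rule iso_relative_homology_prod_two_points)
    let ?V' = "{z. Im z > 0}" and ?U' = "{z. Im z < 0}"
    show "openin ?Y' ?U'" "openin ?Y' ?V'"
      by (rule open_subset; auto simp: open_halfspace_Im_lt open_halfspace_Im_gt)+
    have "{z. Im z \<noteq> 0} \<inter> ?U' = ?U'" "{z. Im z \<noteq> 0} \<inter> ?V' = ?V'" by auto
    then show "contractible_space (subtopology ?Y' ?U')" "contractible_space (subtopology ?Y' ?V')"
      by (simp_all add: subtopology_subtopology convex_imp_contractible convex_halfspace_Im_lt convex_halfspace_Im_gt)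
    have "- \<i> \<in> ?U'" by simp
    then show "?U' \<noteq> {}" by blast
  qed auto
  finally show ?thesis .
qed

section \<open>Coordinates on \<open>V\<close> and affine charts of the projective line\<close>

lemma V_rel_iff: "V_rel x y \<longleftrightarrow> (\<forall>i. x $ i - x $ 3 = y $ i - y $ 3)"
proof
  assume "V_rel x y"
  then obtain k where k: "x - y = k *s vec 1" by (auto simp: V_rel_def vec.span_singleton)
  have "x $ i = y $ i + k" for i
    using arg_cong[OF k, of "\<lambda>z. z $ i"] by (simp add: algebra_simps)
  then show "\<forall>i. x $ i - x $ 3 = y $ i - y $ 3" by simp
next
  assume "\<forall>i. x $ i - x $ 3 = y $ i - y $ 3"
  then have "x - y = (x $ 3 - y $ 3) *s vec 1"
    by (simp add: vec_eq_iff) (metis diff_eq_diff_eq diff_diff_eq2 add.commute)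
  then show "V_rel x y"
    unfolding V_rel_def vec.span_singleton by blast
qed

text \<open>The forms for \<open>i = 1\<close> and \<open>i = 2\<close> are coordinates on \<open>V\<close>, and \<open>P1_chart i j\<close> is their quotient as
  an affine coordinate on the lines where the form \<open>j\<close> does not vanish.\<close>

lift_definition V_form :: "3 \<Rightarrow> V \<Rightarrow> complex" is "\<lambda>i x. x $ i - x $ 3"
  by (simp add: V_rel_iff)

lemma V_form_scaleV: "V_form i (scaleV c v) = c * V_form i v"
  by transfer (simp add: algebra_simps)

lemma V_form_add: "V_form i (v + w) = V_form i v + V_form i w"
  by transfer (simp add: algebra_simps)

lemma V_form_0 [simp]: "V_form i 0 = 0"
  by transfer simp

lemma V_eq_iff: "v = w \<longleftrightarrow> V_form 1 v = V_form 1 w \<and> V_form 2 v = V_form 2 w"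
  by transfer (simp add: V_rel_iff forall_3)

lemma continuous_map_V_form: "continuous_map V_topology euclidean (V_form i)"
proof (rule continuous_compose_quotient_map)
  show "quotient_map euclidean V_topology abs_V"
    unfolding V_topology_def by (rule quotient_map_quotient_topology)
  have "V_form i \<circ> abs_V = (\<lambda>x. x $ i - x $ 3)" by (auto simp: V_form.abs_eq)
  then show "continuous_map euclidean euclidean (V_form i \<circ> abs_V)"
    by (auto intro!: continuous_intros)
qed

lemma quotient_map_P1: "quotient_map (subtopology V_topology (- {0})) P1_topology (\<lambda>v. V.span {v})"
  unfolding P1_topology_def by (rule quotient_map_quotient_topology)

lemma V_lines_eq: "V_lines = (\<lambda>v. V.span {v}) ` (- {0})"
  using topspace_P1_topology unfolding P1_topology_def by simp

definition P1_chart_dom :: "3 \<Rightarrow> V set set" where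
  "P1_chart_dom j = {L \<in> V_lines. \<exists>v\<in>L. V_form j v \<noteq> 0}"

definition P1_chart :: "3 \<Rightarrow> 3 \<Rightarrow> V set \<Rightarrow> complex" where
  "P1_chart i j L = (let v = SOME v. v \<in> L \<and> V_form j v \<noteq> 0 in V_form i v / V_form j v)"

lemma span_in_P1_chart_dom_iff: "V.span {v} \<in> P1_chart_dom j \<longleftrightarrow> V_form j v \<noteq> 0"
proof
  assume "V_form j v \<noteq> 0"
  then have "v \<noteq> 0" by auto
  then show "V.span {v} \<in> P1_chart_dom j"
    using \<open>V_form j v \<noteq> 0\<close> V.span_base[of v "{v}"] by (auto simp: P1_chart_dom_def V_lines_eq)
qed (auto simp: P1_chart_dom_def V.span_singleton V_form_scaleV)

text \<open>The vector picked by \<open>SOME\<close> is a nonzero multiple of \<open>v\<close>, and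
  the quotient of two linear forms is invariant under scaling.\<close>

lemma P1_chart_span:
  assumes "V_form j v \<noteq> 0"
  shows "P1_chart i j (V.span {v}) = V_form i v / V_form j v"
proof -
  define w where "w = (SOME w. w \<in> V.span {v} \<and> V_form j w \<noteq> 0)"
  have "w \<in> V.span {v} \<and> V_form j w \<noteq> 0"
    unfolding w_def by (rule someI[of _ v]) (use assms V.span_base[of v "{v}"] in auto)
  then obtain k where k: "w = scaleV k v" and "V_form j (scaleV k v) \<noteq> 0"
    by (auto simp: V.span_singleton)
  then have "k \<noteq> 0" by (auto simp: V_form_scaleV)
  then show ?thesis
    by (simp add: P1_chart_def flip: w_def) (simp add: V_form_scaleV k)
qed

lemma openin_P1_chart_dom: "openin P1_topology (P1_chart_dom j)"
proof -
  have "openin V_topology {v \<in> topspace V_topology. V_form j v \<in> - {0}}"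
    by (rule openin_continuous_map_preimage[OF continuous_map_V_form]) auto
  then have "openin (subtopology V_topology (- {0})) {v \<in> topspace V_topology. V_form j v \<in> - {0}}"
    by (auto simp: openin_subtopology intro!: exI[of _ "{v. V_form j v \<noteq> 0}"])
  moreover have "{v \<in> - {0}. V.span {v} \<in> P1_chart_dom j} = {v \<in> topspace V_topology. V_form j v \<in> - {0}}"
    by (auto simp: span_in_P1_chart_dom_iff)
  moreover have "P1_chart_dom j \<subseteq> V_lines" by (auto simp: P1_chart_dom_def)
  ultimately show ?thesis
    unfolding P1_topology_def openin_quotient_topology by (simp add: V_lines_eq)
qed

text \<open>Over an open set of lines the span map restricts to a quotient map, so continuity can be
  tested on vectors, where the chart is a quotient of two continuous forms with nonvanishing
  denominator.\<close>

lemma continuous_map_P1_chart: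
  "continuous_map (subtopology P1_topology (P1_chart_dom j)) euclidean (P1_chart i j)"
proof (rule continuous_compose_quotient_map)
  let ?X = "subtopology V_topology (- {0})" and ?D = "{v. V_form j v \<noteq> 0}"
  have eq: "{v \<in> topspace ?X. V.span {v} \<in> P1_chart_dom j} = ?D"
    by (auto simp: span_in_P1_chart_dom_iff)
  show "quotient_map (subtopology ?X ?D) (subtopology P1_topology (P1_chart_dom j)) (\<lambda>v. V.span {v})"
    by (rule quotient_map_restriction[OF quotient_map_P1 eq]) (simp add: openin_P1_chart_dom)
  have "continuous_map (subtopology ?X ?D) (top_of_set (UNIV \<times> - {0})) (\<lambda>v. (V_form i v, V_form j v))"
    using continuous_map_V_form
    by (auto simp: continuous_map_in_subtopology continuous_map_pairwise o_def
        continuous_map_from_subtopology simp flip: euclidean_product_topology prod_topology_euclidean)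
  moreover have "continuous_map (top_of_set (UNIV \<times> - {0::complex})) euclidean (\<lambda>(x, y). x / y :: complex)"
    by (auto simp: case_prod_unfold intro!: continuous_intros)
  ultimately have "continuous_map (subtopology ?X ?D) euclidean
      ((\<lambda>(x, y). x / y) \<circ> (\<lambda>v. (V_form i v, V_form j v)))"
    by (rule continuous_map_compose)
  then show "continuous_map (subtopology ?X ?D) euclidean (P1_chart i j \<circ> (\<lambda>v. V.span {v}))"
    by (rule continuous_map_eq) (auto simp: P1_chart_span)
qed

text \<open>Each line in the domain contains exactly one vector whose form \<open>j\<close> equals
  \<open>1\<close>; its form \<open>i\<close> is the affine coordinate, which explains the inverse
  map.\<close>

lemma homeomorphic_maps_P1_chart:
  assumes ij: "(i, j) = (1, 2) \<or> (i, j) = (2, 1)"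
  shows "homeomorphic_maps (subtopology P1_topology (P1_chart_dom j)) euclidean
    (P1_chart i j) (\<lambda>z. V.span {abs_V (axis i z + axis j 1)})"
proof -
  let ?g = "\<lambda>z. abs_V (axis i z + axis j 1)"
  have eq_iff: "v = w \<longleftrightarrow> V_form i v = V_form i w \<and> V_form j v = V_form j w" for v w
    using ij V_eq_iff[of v w] by auto
  have form: "V_form i (?g z) = z" "V_form j (?g z) = 1" for z
    using ij by (auto simp: V_form.abs_eq axis_def)
  then have ne: "?g z \<noteq> 0" for z by (metis V_form_0 zero_neq_one)
  have "continuous_map euclidean V_topology (abs_V \<circ> (\<lambda>z. axis i z + axis j 1))"
  proof (rule continuous_map_compose)
    have "continuous_on UNIV (\<lambda>z::complex. axis i z + axis j 1 :: complex^3)"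
      unfolding axis_def
    proof (intro continuous_on_add continuous_on_vec_lambda continuous_on_const)
      show "continuous_on UNIV (\<lambda>z. if k = i then z else 0 :: complex)" for k
        by (cases "k = i") (simp_all add: continuous_on_id)
    qed
    then show "continuous_map euclidean euclidean (\<lambda>z::complex. axis i z + axis j 1 :: complex^3)" by simp
    show "continuous_map euclidean V_topology abs_V"
      unfolding V_topology_def by (rule quotient_imp_continuous_map[OF quotient_map_quotient_topology])
  qed
  then have "continuous_map euclidean (subtopology V_topology (- {0})) ?g"
    using ne by (auto simp: continuous_map_in_subtopology o_def)
  from continuous_map_compose[OF this quotient_imp_continuous_map[OF quotient_map_P1]]
  have "continuous_map euclidean (subtopology P1_topology (P1_chart_dom j)) (\<lambda>z. V.span {?g z})"
    by (auto simp: continuous_map_in_subtopology o_def span_in_P1_chart_dom_iff form)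
  moreover have "V.span {?g (P1_chart i j L)} = L" if L: "L \<in> P1_chart_dom j" for L
  proof -
    obtain v where v: "L = V.span {v}" using L unfolding P1_chart_dom_def V_lines_eq by blast
    then have j: "V_form j v \<noteq> 0" using L by (simp add: span_in_P1_chart_dom_iff)
    have "v = scaleV (V_form j v) (?g (P1_chart i j L))"
      using j by (simp add: eq_iff V_form_scaleV form v P1_chart_span)
    moreover have "?g (P1_chart i j L) = scaleV (inverse (V_form j v)) v"
      using j by (simp add: eq_iff V_form_scaleV form v P1_chart_span divide_inverse)
    ultimately have "v \<in> V.span {?g (P1_chart i j L)}" "?g (P1_chart i j L) \<in> V.span {v}"
      by (metis V.span_base V.span_scale insertI1)+
    then show ?thesis unfolding v
      by (intro equalityI V.span_minimal) auto
  qed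
  ultimately show ?thesis
    unfolding homeomorphic_maps_def
    using continuous_map_P1_chart by (auto simp: P1_chart_span form)
qed

lemma P1_chart_dom_cover: "P1_chart_dom 1 \<union> P1_chart_dom 2 = V_lines"
proof (intro equalityI subsetI)
  fix L assume "L \<in> V_lines"
  then obtain v where "L = V.span {v}" "v \<noteq> 0" unfolding V_lines_eq by blast
  then show "L \<in> P1_chart_dom 1 \<union> P1_chart_dom 2"
    by (auto simp: span_in_P1_chart_dom_iff V_eq_iff)
qed (auto simp: P1_chart_dom_def)

text \<open>The two affine charts are contractible, so the suspension step lowers the degree once;
  the coordinate \<open>P1_chart 1 2\<close> maps their overlap to the punctured plane, which lowers
  it once more.\<close>

lemma iso_relative_homology_prod_P1:
  "\<exists>c \<in> V_lines. relative_homology_group p (prod_topology X P1_topology) (topspace X \<times> {c})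
     \<cong> homology_group (p - 2) X"
proof -
  let ?U = "P1_chart_dom 2" and ?V = "P1_chart_dom 1"
  \<comment> \<open>Both forms take the value \<open>1\<close> on this vector, so its line lies in
    both charts and has coordinate \<open>1\<close>, the base point chosen in the punctured
    plane.\<close>
  let ?c = "V.span {abs_V (axis 1 1 + axis 2 1)}"
  have form: "V_form 1 (abs_V (axis 1 1 + axis 2 1)) = 1" "V_form 2 (abs_V (axis 1 1 + axis 2 1)) = 1"
    by (simp_all add: V_form.abs_eq axis_def)
  then have c: "?c \<in> ?U \<inter> ?V" by (simp add: span_in_P1_chart_dom_iff)
  have homeo: "homeomorphic_map (subtopology P1_topology ?U) euclidean (P1_chart 1 2)"
    "homeomorphic_map (subtopology P1_topology ?V) euclidean (P1_chart 2 1)"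
    using homeomorphic_maps_P1_chart[of 1 2] homeomorphic_maps_P1_chart[of 2 1]
    by (auto simp: homeomorphic_map_maps)
  have contractible: "contractible_space (subtopology P1_topology ?U)" "contractible_space (subtopology P1_topology ?V)"
    using homeo[THEN homeomorphic_map_imp_homeomorphic_space, THEN homeomorphic_space_contractibility]
      contractible_space_top_of_set[of "UNIV :: complex set"] by simp_all
  have "relative_homology_group p (prod_topology X P1_topology) (topspace X \<times> {?c})
     \<cong> relative_homology_group (p - 1) (prod_topology X (subtopology P1_topology (?U \<inter> ?V))) (topspace X \<times> {?c})"
    using contractible c P1_chart_dom_cover
    by (intro iso_relative_homology_prod_suspension) (auto simp: openin_P1_chart_dom)
  also have "\<dots> \<cong> relative_homology_group (p - 1) (prod_topology X (top_of_set (- {0}))) (topspace X \<times> {P1_chart 1 2 ?c})"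
  proof (rule iso_relative_homology_prod_homeomorphic)
    have "homeomorphic_map (subtopology (subtopology P1_topology ?U) ?V) (top_of_set (- {0})) (P1_chart 1 2)"
    proof (rule homeomorphic_map_subtopologies_alt[OF homeo(1)])
      fix L assume "L \<in> topspace (subtopology P1_topology ?U)"
      then obtain v where v: "L = V.span {v}" "L \<in> ?U" by (auto simp: V_lines_eq)
      then show "P1_chart 1 2 L \<in> - {0} \<longleftrightarrow> L \<in> ?V"
        by (auto simp: span_in_P1_chart_dom_iff P1_chart_span)
    qed
    then show "homeomorphic_map (subtopology P1_topology (?U \<inter> ?V)) (top_of_set (- {0})) (P1_chart 1 2)"
      by (simp add: subtopology_subtopology)
  qed (use c P1_chart_dom_cover in auto)
  also have "P1_chart 1 2 ?c = 1" by (simp add: P1_chart_span form)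
  also have "relative_homology_group (p - 1) (prod_topology X (top_of_set (- {0::complex}))) (topspace X \<times> {1})
     \<cong> homology_group (p - 1 - 1) X"
    by (rule iso_relative_homology_prod_punctured_plane)
  finally have "relative_homology_group p (prod_topology X P1_topology) (topspace X \<times> {?c}) \<cong> homology_group (p - 2) X"
    by simp
  then show ?thesis using c P1_chart_dom_cover by blast
qed

theorem iso_homology_prod_P1:
  "homology_group p (prod_topology X P1_topology) \<cong> homology_group p X \<times>\<times> homology_group (p - 2) X"
proof -
  obtain c where c: "c \<in> V_lines"
    "relative_homology_group p (prod_topology X P1_topology) (topspace X \<times> {c}) \<cong> homology_group (p - 2) X"
    using iso_relative_homology_prod_P1 by blast
  have "homology_group p (prod_topology X P1_topology)
      \<cong> homology_group p X \<times>\<times> relative_homology_group p (prod_topology X P1_topology) (topspace X \<times> {c})"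
    using c(1) by (intro iso_homology_prod_split) simp
  also have "\<dots> \<cong> homology_group p X \<times>\<times> homology_group (p - 2) X"
    by (rule group.DirProd_iso_trans[OF _ iso_refl c(2)]) simp
  finally show ?thesis .
qed

section \<open>Euler characteristic of powers of the projective line\<close>

lemma homeomorphic_space_product_topology_insert:
  assumes "a \<notin> K"
  shows "product_topology X (insert a K) homeomorphic_space prod_topology (product_topology X K) (X a)"
proof -
  let ?f = "\<lambda>f. (restrict f K, f a)" and ?g = "\<lambda>(h, y). \<lambda>i\<in>insert a K. if i = a then y else h i"
  have "homeomorphic_maps (product_topology X (insert a K)) (prod_topology (product_topology X K) (X a)) ?f ?g"
    unfolding homeomorphic_maps_def
  proof (intro conjI ballI)
    show "continuous_map (product_topology X (insert a K)) (prod_topology (product_topology X K) (X a)) ?f"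
      by (auto simp: continuous_map_pairwise o_def continuous_map_componentwise
          intro!: continuous_map_product_projection)
    show "continuous_map (prod_topology (product_topology X K) (X a)) (product_topology X (insert a K)) ?g"
      unfolding continuous_map_componentwise
    proof (intro conjI ballI)
      fix i assume i: "i \<in> insert a K"
      show "continuous_map (prod_topology (product_topology X K) (X a)) (X i) (\<lambda>x. ?g x i)"
      proof (cases "i = a")
        case True
        then show ?thesis by (simp add: case_prod_unfold continuous_map_snd)
      next
        case False
        then have "continuous_map (prod_topology (product_topology X K) (X a)) (X i) ((\<lambda>f. f i) \<circ> fst)"
          using i by (intro continuous_map_compose[OF continuous_map_fst] continuous_map_product_projection) auto
        then show ?thesis using False i by (simp add: case_prod_unfold o_def)
      qed
    qed auto
  next
    fix f assume "f \<in> topspace (product_topology X (insert a K))"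
    then show "?g (?f f) = f" by (fastforce simp: PiE_iff extensional_def fun_eq_iff)
  next
    fix z assume "z \<in> topspace (prod_topology (product_topology X K) (X a))"
    then show "?f (?g z) = z"
      using assms by (auto simp: PiE_iff extensional_def fun_eq_iff)
  qed
  then show ?thesis unfolding homeomorphic_space_def by blast
qed

text \<open>One more factor adds the rank in degree \<open>p - 2\<close> to the rank in degree
  \<open>p\<close>, which is Pascal's rule on even degrees. The degree ranges over the integers
  because the recursion reaches negative degrees.\<close>

lemma homology_group_P1_power:
  assumes "finite K"
  shows "homology_group p (product_topology (\<lambda>_. P1_topology) K)
       \<cong> int_lattice (if p < 0 \<or> odd p then 0 else card K choose nat (p div 2))"
  using assms
proof (induction K arbitrary: p)
  case empty
  have X: "topspace (product_topology (\<lambda>_. P1_topology) {}) = {\<lambda>_. undefined}" by simp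
  show ?case
  proof (cases "p = 0")
    case True
    have "homology_group 0 (product_topology (\<lambda>_. P1_topology) {}) \<cong> int_lattice 1"
      by (rule iso_trans[OF homology_coefficients[OF X] integer_group_iso_int_lattice])
    with True show ?thesis by simp
  next
    case False
    then have "(if p < 0 \<or> odd p then 0 else 0 choose nat (p div 2)) = 0" by auto
    with trivial_group_iso_int_lattice[OF homology_dimension_axiom[OF X False]] show ?thesis
      by (simp only: card.empty)
  qed
next
  case (insert a K)
  let ?b = "\<lambda>k p. if p < 0 \<or> odd p then 0 else k choose nat (p div 2 :: int)"
  let ?X = "product_topology (\<lambda>_. P1_topology) K"
  have b: "?b (card K) p + ?b (card K) (p - 2) = ?b (card (insert a K)) p"
  proof (cases "p < 0 \<or> odd p")
    case False
    then obtain m where m: "p = 2 * int m" by (metis evenE not_less nonneg_int_cases zero_le_mult_iff zero_less_numeral not_numeral_less_zero order.asym)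
    show ?thesis
    \<comment> \<open>For \<open>m = 0\<close> the second summand sits in degree \<open>-2\<close>
      and vanishes; for \<open>m = Suc n\<close> the equation is Pascal's rule.\<close>
    proof (cases m)
      case (Suc n)
      have "nat ((p - 2) div 2) = n" "nat (p div 2) = Suc n" "\<not> p - 2 < 0" "even (p - 2)" "even p" "\<not> p < 0"
        using m Suc by auto
      then show ?thesis using insert by (simp add: add.commute)
    qed (use m insert in simp)
  qed auto
  have "homology_group p (product_topology (\<lambda>_. P1_topology) (insert a K)) \<cong> homology_group p (prod_topology ?X P1_topology)"
    using insert homeomorphic_space_product_topology_insert[of a K "\<lambda>_. P1_topology"]
    by (intro homeomorphic_space_imp_isomorphic_homology_groups) simp
  also have "\<dots> \<cong> homology_group p ?X \<times>\<times> homology_group (p - 2) ?X"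
    by (rule iso_homology_prod_P1)
  also have "\<dots> \<cong> int_lattice (?b (card K) p) \<times>\<times> int_lattice (?b (card K) (p - 2))"
    by (rule group.DirProd_iso_trans[OF _ insert.IH insert.IH]) simp
  also have "\<dots> \<cong> int_lattice (?b (card K) p + ?b (card K) (p - 2))"
    by (rule int_lattice_prod)
  finally show ?case unfolding b .
qed

lemma betti_P1_power:
  assumes "finite K"
  shows "betti p (product_topology (\<lambda>_. P1_topology) K) = (if odd p then 0 else card K choose (p div 2))"
proof -
  have "betti p (product_topology (\<lambda>_. P1_topology) K)
      = abelian_rank (int_lattice (if int p < 0 \<or> odd (int p) then 0 else card K choose nat (int p div 2)))"
    unfolding betti_def
    by (intro abelian_rank_iso homology_group_P1_power assms comm_group_int_lattice) simp
  also have "\<dots> = (if odd p then 0 else card K choose (p div 2))"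
    unfolding abelian_rank_int_lattice by (auto simp: nat_div_distrib)
  finally show ?thesis .
qed

text \<open>Only even degrees contribute, so all signs are positive and the sum is a full row of
  binomial coefficients.\<close>

lemma euler_characteristic_P1_power:
  assumes "finite K"
  shows "euler_characteristic (product_topology (\<lambda>_. P1_topology) K) = 2 ^ card K"
proof -
  let ?X = "product_topology (\<lambda>_. P1_topology) K"
  have "{p. betti p ?X \<noteq> 0} = (\<lambda>j. 2 * j) ` {..card K}"
  proof (intro equalityI subsetI)
    fix p assume "p \<in> {p. betti p ?X \<noteq> 0}"
    then have "even p" "card K choose (p div 2) \<noteq> 0"
      using betti_P1_power[OF assms, of p] by (auto split: if_splits)
    then show "p \<in> (\<lambda>j. 2 * j) ` {..card K}"
      by (intro image_eqI[of _ _ "p div 2"]) (auto simp: not_less)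
  qed (auto simp: betti_P1_power[OF assms])
  moreover have "inj_on (\<lambda>j::nat. 2 * j) {..card K}" by (auto simp: inj_on_def)
  ultimately have "euler_characteristic ?X = (\<Sum>j\<le>card K. int (card K choose j))"
    unfolding euler_characteristic_def by (simp add: sum.reindex betti_P1_power[OF assms])
  also have "\<dots> = 2 ^ card K"
    using choose_row_sum[of "card K"] by (metis of_nat_sum of_nat_power of_nat_numeral)
  finally show ?thesis .
qed

lemma euler_characteristic_homeomorphic_space:
  assumes "X homeomorphic_space Y"
  shows "euler_characteristic X = euler_characteristic Y"
proof -
  have "betti p X = betti p Y" for p
    unfolding betti_def
    by (intro abelian_rank_iso homeomorphic_space_imp_isomorphic_homology_groups assms) simp_all
  then show ?thesis by (simp add: euler_characteristic_def)
qed

section \<open>Functions constant on components\<close>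

lemma rtrancl_converse_invariant:
  assumes "(w, x) \<in> (R \<union> R\<inverse>)\<^sup>*" "\<And>n w. (n, w) \<in> R \<Longrightarrow> f n = f w"
  shows "f w = f x"
  using assms(1) by (induction rule: rtrancl_induct) (auto dest: assms(2))

text \<open>Functions that are constant along \<open>R\<close> and prescribed on \<open>F\<close> are determined by arbitrary values
  on one representative of each connected component not meeting \<open>F\<close>. The unions of such
  components are the same functions with values in a two-point set.\<close>

lemma constrained_functions_free_components:
  fixes Y :: "'b topology" and L :: "'a set"
  assumes "finite L" and R: "R \<subseteq> L \<times> L" and F: "fst ` F \<subseteq> L"
    and S: "S = {l \<in> L \<rightarrow>\<^sub>E topspace Y. (\<forall>(n, w)\<in>R. l n = l w) \<and> (\<forall>(w, x)\<in>F. l w = x)}" "S \<noteq> {}"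
  obtains K :: "'a set" where "finite K"
    "subtopology (product_topology (\<lambda>_. Y) L) S homeomorphic_space product_topology (\<lambda>_. Y) K"
    "card {T. T \<subseteq> L \<and> (\<forall>(n, w)\<in>R. n \<in> T \<longleftrightarrow> w \<in> T) \<and> T \<inter> fst ` F = {}} = 2 ^ card K"
proof -
  define E where "E = (R \<union> R\<inverse>)\<^sup>*"
  have "sym E" unfolding E_def by (intro sym_rtrancl) (auto simp: sym_def)
  then have E_sym: "(w, x) \<in> E \<Longrightarrow> (x, w) \<in> E" for w x by (auto simp: sym_def)
  have E_trans: "(w, x) \<in> E \<Longrightarrow> (x, y) \<in> E \<Longrightarrow> (w, y) \<in> E" for w x y
    unfolding E_def by (rule rtrancl_trans)
  have E_refl: "(w, w) \<in> E" for w unfolding E_def by simp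
  have R_E: "(w, x) \<in> R \<Longrightarrow> (w, x) \<in> E" for w x unfolding E_def by auto
  note E_invariant = rtrancl_converse_invariant[of _ _ R, folded E_def]
  have E_L: "w \<in> L \<longleftrightarrow> x \<in> L" if "(w, x) \<in> E" for w x
    using E_invariant[OF that, of "\<lambda>w. w \<in> L"] R by auto
  \<comment> \<open>\<open>E\<close> is the equivalence relation generated by \<open>R\<close>; one
    representative is chosen in each class, the same for all its members by
    \<open>rep_cong\<close>.\<close>
  define rep where "rep w = (SOME x. (w, x) \<in> E)" for w
  have rep: "(w, rep w) \<in> E" for w unfolding rep_def by (rule someI[of _ w]) (rule E_refl)
  have rep_cong: "rep w = rep x" if "(w, x) \<in> E" for w x
  proof -
    have "(w, y) \<in> E \<longleftrightarrow> (x, y) \<in> E" for y using that E_sym E_trans by blast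
    then show ?thesis unfolding rep_def by simp
  qed
  define Free where "Free = {w \<in> L. \<forall>x. (w, x) \<in> E \<longrightarrow> x \<notin> fst ` F}"
  have Free_cong: "w \<in> Free \<longleftrightarrow> x \<in> Free" if "(w, x) \<in> E" for w x
    unfolding Free_def using that E_sym E_trans E_L by blast
  define K where "K = rep ` Free"
  have K: "rep k = k" "k \<in> Free" "k \<in> L" if k: "k \<in> K" for k
  proof -
    obtain w where w: "w \<in> Free" "k = rep w" using k unfolding K_def by blast
    with rep[of w] have wk: "(w, k) \<in> E" by simp
    from rep_cong[OF wk] w(2) show "rep k = k" by metis
    from Free_cong[OF wk] w(1) show "k \<in> Free" by blast
    then show "k \<in> L" by (simp add: Free_def)
  qed
  have rep_K: "w \<in> Free \<Longrightarrow> rep w \<in> K" for w by (auto simp: K_def)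
  have "K \<subseteq> L" using K(3) by blast
  then have fin: "finite K" using assms(1) finite_subset by blast
  \<comment> \<open>A fixed solution supplies the values on the components meeting the prescribed
    set, where all solutions agree (\<open>S_notFree\<close>).\<close>
  obtain l0 where l0: "l0 \<in> S" using S(2) by blast
  have S_E: "l w = l x" if "l \<in> S" "(w, x) \<in> E" for l w x
    using that E_invariant[OF that(2), of l] unfolding S(1) by blast
  have S_F: "l w = x" if "l \<in> S" "(w, x) \<in> F" for l w x
    using that unfolding S(1) by auto
  have S_notFree: "l w = l0 w" if l: "l \<in> S" "w \<in> L - Free" for l w
  proof -
    obtain x y where "(w, x) \<in> E" "(x, y) \<in> F" using l(2) by (auto simp: Free_def)
    moreover from this have "l x = y" "l0 x = y" using S_F l(1) l0 by blast+
    ultimately show ?thesis using S_E[OF l(1)] S_E[OF l0] by metis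
  qed
  \<comment> \<open>The inverse of restriction to the representatives \<open>K\<close>: values
    spread along free components, and \<open>l0\<close> is used elsewhere.\<close>
  define ext where "ext g = (\<lambda>w\<in>L. if w \<in> Free then g (rep w) else l0 w)" for g :: "_ \<Rightarrow> 'b"
  have ext_S: "ext g \<in> S" if g: "g \<in> K \<rightarrow>\<^sub>E topspace Y" for g
    unfolding S(1)
  proof (intro CollectI conjI ballI PiE_I; (clarify)?)
    show "ext g w \<in> topspace Y" if "w \<in> L" for w
      using that g l0 rep_K by (auto simp: ext_def S(1))
    show "ext g w = undefined" if "w \<notin> L" for w
      using that by (simp add: ext_def)
    show "ext g n = ext g w" if "(n, w) \<in> R" for n w
      using that R rep_cong[OF R_E[OF that]] Free_cong[OF R_E[OF that]] S_E[OF l0 R_E[OF that]]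
      by (auto simp: ext_def)
    show "ext g w = x" if "(w, x) \<in> F" for w x
    proof -
      have "w \<in> L" "w \<notin> Free" using that F E_refl[of w] by (force simp: Free_def)+
      moreover have "l0 w = x" using S_F[OF l0 that] .
      ultimately show ?thesis by (simp add: ext_def)
    qed
  qed
  have "homeomorphic_maps (subtopology (product_topology (\<lambda>_. Y) L) S) (product_topology (\<lambda>_. Y) K)
      (\<lambda>l. restrict l K) ext"
    unfolding homeomorphic_maps_def
  proof (intro conjI ballI)
    show "continuous_map (subtopology (product_topology (\<lambda>_. Y) L) S) (product_topology (\<lambda>_. Y) K) (\<lambda>l. restrict l K)"
      unfolding continuous_map_componentwise
      using \<open>K \<subseteq> L\<close> by (auto intro!: continuous_map_from_subtopology continuous_map_product_projection)
    have "continuous_map (product_topology (\<lambda>_. Y) K) (product_topology (\<lambda>_. Y) L) ext"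
      unfolding continuous_map_componentwise
    proof (intro conjI ballI)
      fix w assume w: "w \<in> L"
      then have "l0 w \<in> topspace Y" using l0 by (auto simp: S(1))
      with w show "continuous_map (product_topology (\<lambda>_. Y) K) Y (\<lambda>g. ext g w)"
        using continuous_map_product_projection[OF rep_K, of w "\<lambda>_. Y"]
        by (cases "w \<in> Free") (simp_all add: ext_def)
    qed (auto simp: ext_def)
    then show "continuous_map (product_topology (\<lambda>_. Y) K) (subtopology (product_topology (\<lambda>_. Y) L) S) ext"
      using ext_S by (auto simp: continuous_map_in_subtopology)
  next
    fix l assume "l \<in> topspace (subtopology (product_topology (\<lambda>_. Y) L) S)"
    then have l: "l \<in> S" "l \<in> L \<rightarrow>\<^sub>E topspace Y" by auto
    show "ext (restrict l K) = l"
    proof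
      fix w show "ext (restrict l K) w = l w"
        using PiE_arb[OF l(2), of w] rep_K[of w] S_E[OF l(1) rep[of w], symmetric] S_notFree[OF l(1), of w]
        by (cases "w \<in> L"; cases "w \<in> Free") (simp_all add: ext_def)
    qed
  next
    fix g assume "g \<in> topspace (product_topology (\<lambda>_. Y) K)"
    then have "g \<in> K \<rightarrow>\<^sub>E topspace Y" by simp
    then have g: "g k = undefined" if "k \<notin> K" for k using that by (auto intro: PiE_arb)
    show "restrict (ext g) K = g"
    proof
      fix k show "restrict (ext g) K k = g k"
        using K[of k] g[of k] by (cases "k \<in> K") (simp_all add: ext_def)
    qed
  qed
  then have homeo: "subtopology (product_topology (\<lambda>_. Y) L) S homeomorphic_space product_topology (\<lambda>_. Y) K"
    unfolding homeomorphic_space_def by blast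
  let ?\<T> = "{T. T \<subseteq> L \<and> (\<forall>(n, w)\<in>R. n \<in> T \<longleftrightarrow> w \<in> T) \<and> T \<inter> fst ` F = {}}"
  have T_E: "w \<in> T \<longleftrightarrow> x \<in> T" if "T \<in> ?\<T>" "(w, x) \<in> E" for T w x
    using E_invariant[OF that(2), of "\<lambda>w. w \<in> T"] that(1) by blast
  have T_Free: "T \<subseteq> Free" if T: "T \<in> ?\<T>" for T
  proof
    fix w assume w: "w \<in> T"
    have "x \<notin> fst ` F" if "(w, x) \<in> E" for x
      using T_E[OF T that] w T by blast
    then show "w \<in> Free" using w T by (auto simp: Free_def)
  qed
  \<comment> \<open>The same correspondence for indicator functions: a union of free components is
    determined by the representatives it contains.\<close>
  have "bij_betw (\<lambda>T. T \<inter> K) ?\<T> (Pow K)"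
  proof (rule bij_betw_byWitness[where f' = "\<lambda>M. {w \<in> Free. rep w \<in> M}"])
    show "\<forall>T\<in>?\<T>. {w \<in> Free. rep w \<in> T \<inter> K} = T"
    proof
      fix T assume T: "T \<in> ?\<T>"
      have "w \<in> Free \<and> rep w \<in> T \<inter> K \<longleftrightarrow> w \<in> T" for w
        using T_Free[OF T] T_E[OF T rep[of w]] rep_K[of w] by blast
      then show "{w \<in> Free. rep w \<in> T \<inter> K} = T" by blast
    qed
    show "\<forall>M\<in>Pow K. {w \<in> Free. rep w \<in> M} \<inter> K = M"
      using K by auto
    show "(\<lambda>M. {w \<in> Free. rep w \<in> M}) ` Pow K \<subseteq> ?\<T>"
    proof (intro image_subsetI CollectI conjI ballI; (clarify)?)
      fix M n w assume "(n, w) \<in> R"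
      then show "n \<in> {w \<in> Free. rep w \<in> M} \<longleftrightarrow> w \<in> {w \<in> Free. rep w \<in> M}"
        using rep_cong[OF R_E] Free_cong[OF R_E] by simp
    next
      fix M show "{w \<in> Free. rep w \<in> M} \<inter> fst ` F = {}"
        using E_refl by (auto simp: Free_def)
    qed (auto simp: Free_def)
  qed auto
  then have "card ?\<T> = 2 ^ card K"
    by (simp add: bij_betw_same_card card_Pow fin)
  with fin homeo show ?thesis by (rule that)
qed

section \<open>Dimensions of subspaces of the plane \<open>V\<close>\<close>

text \<open>The two vectors are dual to the forms \<open>V_form 1\<close> and
  \<open>V_form 2\<close>. The rewrites make the facts on finite dimension speak of the span,
  subspaces and dimension already in use.\<close>

interpretation V: finite_dimensional_vector_space scaleV "{abs_V (axis 1 1), abs_V (axis 2 1)}"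
  rewrites "module.span scaleV = V.span" and "module.subspace scaleV = V.subspace"
    and "vector_space.dim scaleV = V.dim"
proof -
  show "finite_dimensional_vector_space scaleV {abs_V (axis 1 1), abs_V (axis 2 1)}"
  proof (unfold_locales, fold V_span_def)
    have form: "V_form 1 (abs_V (axis 1 1)) = 1" "V_form 2 (abs_V (axis 1 1)) = 0"
      "V_form 1 (abs_V (axis 2 1)) = 0" "V_form 2 (abs_V (axis 2 1)) = 1"
      by (simp_all add: V_form.abs_eq axis_def)
    have "abs_V (axis 2 1) \<noteq> 0" using form(4) by (metis V_form_0 zero_neq_one)
    moreover have "abs_V (axis 1 1) \<notin> V.span {abs_V (axis 2 1)}"
      using form by (auto simp: V.span_singleton V_eq_iff V_form_scaleV)
    ultimately show "V.independent {abs_V (axis 1 1), abs_V (axis 2 1)}"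
      by (auto simp: V.independent_insert)
    show "V.span {abs_V (axis 1 1), abs_V (axis 2 1)} = UNIV"
    proof (intro equalityI subsetI)
      fix v :: V
      have "v = scaleV (V_form 1 v) (abs_V (axis 1 1)) + scaleV (V_form 2 v) (abs_V (axis 2 1))"
        by (simp add: V_eq_iff V_form_scaleV V_form_add form)
      then show "v \<in> V.span {abs_V (axis 1 1), abs_V (axis 2 1)}"
        by (metis V.span_add V.span_base V.span_scale insertI1 insertI2)
    qed simp
  qed simp
qed (simp_all add: V_span_def V_subspace_def V_dim_def)

lemma V_dim_UNIV: "V.dim (UNIV :: V set) = 2"
proof -
  have "abs_V (axis 1 1) \<noteq> abs_V (axis 2 1)"
    by (simp add: V_eq_iff V_form.abs_eq axis_def)
  then show ?thesis by (simp add: V.dim_UNIV)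
qed

lemma basis_line_in_V_lines: "basis_line i \<in> V_lines"
proof -
  have "abs_V (axis i 1) \<noteq> 0"
    using exhaust_3[of i] by (auto simp: V_eq_iff V_form.abs_eq axis_def)
  then show ?thesis by (auto simp: basis_line_def V_lines_eq)
qed

lemma V_line_subset_dim_1:
  assumes "L \<in> V_lines" "V.subspace S" "V.dim S = 1" "L \<subseteq> S"
  shows "L = S"
  using assms by (intro V.subspace_dim_equal) (auto simp: V_lines_def)

lemma V_line_neq_0: "L \<in> V_lines \<Longrightarrow> \<not> L \<subseteq> {0}"
  using V.dim_eq_0[of L] by (auto simp: V_lines_def)

section \<open>Back neighbours of type III cells\<close>

lemma diagram_downward_closed:
  assumes "is_partition \<nu>" "(u, v) \<in> diagram \<nu>" "0 \<le> u'" "u' \<le> u" "0 \<le> v'" "v' \<le> v"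
  shows "(u', v') \<in> diagram \<nu>"
proof -
  have "\<nu> ! nat v \<le> \<nu> ! nat v'"
  proof (cases "v' = v")
    case False
    then show ?thesis
      using assms by (intro sorted_wrt_nth_less[of "(\<ge>)"]) (auto simp: is_partition_def diagram_def)
  qed simp
  then show ?thesis using assms by (auto simp: diagram_def)
qed

lemma Cyl_iff:
  "w \<in> Cyl \<mu> 1 \<longleftrightarrow> (w $ 2, w $ 3) \<in> diagram (\<mu> 1)"
  "w \<in> Cyl \<mu> 2 \<longleftrightarrow> (w $ 3, w $ 1) \<in> diagram (\<mu> 2)"
  "w \<in> Cyl \<mu> 3 \<longleftrightarrow> (w $ 1, w $ 2) \<in> diagram (\<mu> 3)"
proof -
  have w: "w = vector [w $ 1, w $ 2, w $ 3]" by (simp add: vec_eq_iff forall_3)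
  show "w \<in> Cyl \<mu> 1 \<longleftrightarrow> (w $ 2, w $ 3) \<in> diagram (\<mu> 1)"
    by (simp add: Cyl_def) (use w in \<open>force simp: vector_3\<close>)
  show "w \<in> Cyl \<mu> 2 \<longleftrightarrow> (w $ 3, w $ 1) \<in> diagram (\<mu> 2)"
    by (simp add: Cyl_def) (use w in \<open>force simp: vector_3\<close>)
  show "w \<in> Cyl \<mu> 3 \<longleftrightarrow> (w $ 1, w $ 2) \<in> diagram (\<mu> 3)"
    by (simp add: Cyl_def) (use w in \<open>force simp: vector_3\<close>)
qed

lemma Cyl_downward_closed:
  assumes "is_partition (\<mu> i)" "w \<in> Cyl \<mu> i" "\<And>j. j \<noteq> i \<Longrightarrow> 0 \<le> n $ j \<and> n $ j \<le> w $ j"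
  shows "n \<in> Cyl \<mu> i"
proof -
  consider "i = 1" | "i = 2" | "i = 3" using exhaust_3 by blast
  then show ?thesis
  proof cases
    case 1
    with assms show ?thesis
      by (auto simp: Cyl_iff intro: diagram_downward_closed[where u = "w $ 2" and v = "w $ 3"])
  next
    case 2
    with assms show ?thesis
      by (auto simp: Cyl_iff intro: diagram_downward_closed[where u = "w $ 3" and v = "w $ 1"])
  next
    case 3
    with assms show ?thesis
      by (auto simp: Cyl_iff intro: diagram_downward_closed[where u = "w $ 1" and v = "w $ 2"])
  qed
qed

lemma Cyl_nonneg: "w \<in> Cyl \<mu> i \<Longrightarrow> j \<noteq> i \<Longrightarrow> 0 \<le> w $ j"
  using Cyl_bounded[of \<mu>] by (metis atLeastAtMost_iff)

lemma II_III_nonneg: "w \<in> II \<mu> \<union> III \<mu> \<Longrightarrow> 0 \<le> w $ j"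
  using Cyl_bounded[of \<mu>] II_III_bounded[of \<mu> _ w j] by (metis atLeastAtMost_iff)

lemma III_iff: "w \<in> III \<mu> \<longleftrightarrow> (\<forall>i. w \<in> Cyl \<mu> i)"
  by (auto simp: III_def forall_3)

lemma Cyl_neg_disjoint: "w \<in> Cyl_neg \<mu> i \<Longrightarrow> w \<notin> II \<mu> \<union> III \<mu>"
  using II_III_nonneg by (auto simp: Cyl_neg_def)

lemma I_neg_disjoint: "I_neg \<mu> \<inter> (II \<mu> \<union> III \<mu>) = {}"
  using Cyl_neg_disjoint by (auto simp: I_neg_def)

lemma II_III_disjoint: "II \<mu> \<inter> III \<mu> = {}"
  by (auto simp: II_def II_bar_def III_iff)

lemma BN_iff: "n \<in> BN w \<longleftrightarrow> (\<exists>k. n = w - axis k 1)"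
  by (auto simp: BN_def) (metis exhaust_3)

text \<open>A step back in direction \<open>k\<close> either keeps coordinate \<open>k\<close>
  nonnegative, and the cell stays in all cylinders because diagrams are downward closed, or makes it
  negative, which only cylinder \<open>k\<close> permits. Hence a back neighbour of a type III cell
  is never of type II, and a box outside type III induces a single basis line.\<close>

lemma BN_III_cases:
  assumes \<mu>: "\<And>i. is_partition (\<mu> i)" and w: "w \<in> III \<mu>" and n: "n \<in> BN w"
  obtains "n \<in> III \<mu>" | k where "{j. n \<in> Cyl_neg \<mu> j} = {k}" "n \<in> I_neg \<mu>" "n \<notin> III \<mu>"
proof -
  obtain k where k: "n = w - axis k 1" using n BN_iff by blast
  have w0: "0 \<le> w $ j" for j using II_III_nonneg w by blast
  have n_k: "n $ k = w $ k - 1" "j \<noteq> k \<Longrightarrow> n $ j = w $ j" for j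
    by (auto simp: k axis_def)
  show ?thesis
  proof (cases "0 \<le> n $ k")
    case True
    have "0 \<le> n $ j \<and> n $ j \<le> w $ j" for j
      using True n_k w0[of j] by (cases "j = k") auto
    then have "n \<in> Cyl \<mu> i" for i
      using Cyl_downward_closed[of \<mu> i w n] \<mu> w by (simp add: III_iff)
    then have "n \<in> III \<mu>" by (simp add: III_iff)
    then show ?thesis by (rule that(1))
  next
    case False
    then have "n \<notin> III \<mu>" using II_III_nonneg by blast
    have "w + axis k (-1) \<in> Cyl \<mu> k" using w by (intro Cyl_add_axis) (simp add: III_iff)
    moreover have "w + axis k (-1) = n" by (auto simp: k vec_eq_iff axis_def)
    ultimately have "n \<in> Cyl_neg \<mu> k" using False by (auto simp: Cyl_neg_def)
    moreover have "j = k" if "n \<in> Cyl_neg \<mu> j" for j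
      using that False Cyl_nonneg[of n \<mu> j k] by (auto simp: Cyl_neg_def)
    ultimately have "{j. n \<in> Cyl_neg \<mu> j} = {k}" "n \<in> I_neg \<mu>" unfolding I_neg_def by blast+
    then show ?thesis using \<open>n \<notin> III \<mu>\<close> by (rule that(2))
  qed
qed

section \<open>The space of labellings\<close>

text \<open>The conditions on a labelled box configuration that do not mention the labels.\<close>

definition lbc_base :: "(3 \<Rightarrow> nat list) \<Rightarrow> cell set \<Rightarrow> cell set \<Rightarrow> bool" where
  "lbc_base \<mu> B U \<longleftrightarrow>
    finite B \<and> B \<subseteq> I_neg \<mu> \<union> II \<mu> \<union> III \<mu> \<and> U \<subseteq> B \<inter> III \<mu> \<and>
    (\<forall>w \<in> I_neg \<mu> \<union> III \<mu>. BN w \<inter> B \<noteq> {} \<longrightarrow> w \<in> B) \<and>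
    (\<forall>w \<in> II \<mu> - B. BN w \<inter> B \<subseteq> labelled_boxes \<mu> B U) \<and>
    (\<forall>w \<in> labelled_boxes \<mu> B U. BN w \<inter> U = {})"

definition label_adjacency :: "(3 \<Rightarrow> nat list) \<Rightarrow> cell set \<Rightarrow> cell set \<Rightarrow> (cell \<times> cell) set" where
  "label_adjacency \<mu> B U =
    {(n, w). n \<in> labelled_boxes \<mu> B U \<and> w \<in> labelled_boxes \<mu> B U \<and> n \<in> BN w}"

definition forced_labels :: "(3 \<Rightarrow> nat list) \<Rightarrow> cell set \<Rightarrow> cell set \<Rightarrow> (cell \<times> V set) set" where
  "forced_labels \<mu> B U = {(w, x). w \<in> labelled_boxes \<mu> B U \<and> (\<exists>i. x = basis_line i \<and>
    ((\<exists>w' \<in> II_bar \<mu> i - B. w \<in> BN w') \<or> BN w \<inter> B \<inter> Cyl_neg \<mu> i \<noteq> {}))}"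

text \<open>Every back neighbour that is a box induces a line, or the whole plane if it is
  unlabelled. So the span is nonzero as soon as there is such a neighbour, and it is a line for a
  labelled \<open>w\<close> exactly when all neighbours induce that same line.\<close>

lemma III_condition_iff:
  assumes \<mu>: "\<And>i. is_partition (\<mu> i)" and w: "w \<in> III \<mu>" and U: "U \<subseteq> B \<inter> III \<mu>"
    and l: "l \<in> labelled_boxes \<mu> B U \<rightarrow>\<^sub>E V_lines"
  shows "(induced_span \<mu> B U l w \<noteq> {0} \<longrightarrow> w \<in> B) \<and>
      (V.dim (induced_span \<mu> B U l w) = 1 \<longrightarrow>
        w \<in> labelled_boxes \<mu> B U \<and> l w = induced_span \<mu> B U l w \<or> w \<in> U) \<and>
      (V.dim (induced_span \<mu> B U l w) = 2 \<longrightarrow> w \<in> U)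
    \<longleftrightarrow> (BN w \<inter> B \<noteq> {} \<longrightarrow> w \<in> B) \<and>
      (w \<in> labelled_boxes \<mu> B U \<longrightarrow> (\<forall>n \<in> BN w \<inter> B. n \<notin> U \<and> induced \<mu> U l n = l w))"
    (is "?lhs \<longleftrightarrow> ?rhs")
proof -
  let ?L = "labelled_boxes \<mu> B U" and ?S = "induced_span \<mu> B U l w"
  have line: "n \<notin> U \<Longrightarrow> induced \<mu> U l n \<in> V_lines" and full: "n \<in> U \<Longrightarrow> induced \<mu> U l n = UNIV"
    if n: "n \<in> BN w \<inter> B" for n
  proof -
    from n have "n \<in> BN w" by blast
    show "induced \<mu> U l n \<in> V_lines" if "n \<notin> U"
      using \<mu> w \<open>n \<in> BN w\<close>
    proof (rule BN_III_cases)
      assume "n \<in> III \<mu>"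
      then show ?thesis using \<open>n \<notin> U\<close> n l by (auto simp: induced_def labelled_boxes_def)
    next
      fix k assume "{j. n \<in> Cyl_neg \<mu> j} = {k}" "n \<notin> III \<mu>"
      then show ?thesis by (simp add: induced_def basis_line_in_V_lines)
    qed
    show "n \<in> U \<Longrightarrow> induced \<mu> U l n = UNIV" using U by (auto simp: induced_def)
  qed
  have sub: "induced \<mu> U l n \<subseteq> ?S" if "n \<in> BN w \<inter> B" for n
  proof -
    have "induced \<mu> U l n \<subseteq> (\<Union>n \<in> BN w \<inter> B. induced \<mu> U l n)" using that by (rule UN_upper)
    also have "\<dots> \<subseteq> ?S" unfolding induced_span_def by (rule V.span_superset)
    finally show ?thesis .
  qed
  have S: "V.subspace ?S" by (simp add: induced_span_def)
  have L: "w \<in> ?L \<longleftrightarrow> w \<in> B \<and> w \<notin> U" using w by (auto simp: labelled_boxes_def)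
  have nonzero: "\<not> ?S \<subseteq> {0}" if n: "n \<in> BN w \<inter> B" for n
  proof (cases "n \<in> U")
    case True
    then have "?S = UNIV" using sub[OF n] full[OF n] by blast
    then show ?thesis using V_line_neq_0[OF basis_line_in_V_lines] by blast
  next
    case False
    then show ?thesis using sub[OF n] V_line_neq_0[OF line[OF n]] by blast
  qed
  show ?thesis
  proof
    assume lhs: ?lhs
    show ?rhs
    proof (intro conjI impI ballI)
      assume "BN w \<inter> B \<noteq> {}"
      then obtain n where "n \<in> BN w \<inter> B" by blast
      from nonzero[OF this] lhs show "w \<in> B" by auto
    next
      fix n assume wL: "w \<in> ?L" and n: "n \<in> BN w \<inter> B"
      \<comment> \<open>A labelled box excludes dimension 2 and the neighbour \<open>n\<close>
        excludes 0; in a plane only 1 remains.\<close>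
      have "V.dim ?S \<noteq> 2" using lhs wL L by blast
      moreover have "V.dim ?S \<le> 2" using V.dim_subset[of ?S UNIV] V_dim_UNIV by simp
      moreover have "V.dim ?S \<noteq> 0" using nonzero[OF n] V.dim_eq_0 by blast
      ultimately have dim: "V.dim ?S = 1" by linarith
      then have lw: "l w = ?S" using lhs wL L by blast
      show "n \<notin> U"
      proof
        assume "n \<in> U"
        then have "?S = UNIV" using sub[OF n] full[OF n] by blast
        then show False using dim V_dim_UNIV by simp
      qed
      then show "induced \<mu> U l n = l w"
        unfolding lw by (intro V_line_subset_dim_1 line S dim sub n)
    qed
  next
    assume rhs: ?rhs
    show ?lhs
    proof (cases "BN w \<inter> B = {}")
      case True
      then have "?S = {0}" by (simp add: induced_span_def)
      then show ?thesis by simp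
    next
      case False
      then have "w \<in> B" using rhs by blast
      show ?thesis
      proof (cases "w \<in> U")
        case True
        then show ?thesis using \<open>w \<in> B\<close> by simp
      next
        case notU: False
        then have wL: "w \<in> ?L" using \<open>w \<in> B\<close> L by blast
        then have lw: "V.subspace (l w)" "V.dim (l w) = 1" using l by (auto simp: V_lines_def)
        have "(\<Union>n\<in>BN w \<inter> B. induced \<mu> U l n) = l w"
          using rhs wL False by blast
        then have "?S = l w" using lw by (simp add: induced_span_def V.span_eq_iff)
        then show ?thesis using \<open>w \<in> B\<close> wL lw by simp
      qed
    qed
  qed
qed

text \<open>Separates the conditions on \<open>(B, U)\<close> alone from those on the labels. The
  latter are only equalities between adjacent labels and prescribed values, which is the form
  required by \<open>constrained_functions_free_components\<close>.\<close>

lemma is_lbc_iff: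
  assumes \<mu>: "\<And>i. is_partition (\<mu> i)"
  shows "is_lbc \<mu> B U l \<longleftrightarrow> lbc_base \<mu> B U \<and> l \<in> labelled_boxes \<mu> B U \<rightarrow>\<^sub>E V_lines \<and>
    (\<forall>(n, w)\<in>label_adjacency \<mu> B U. l n = l w) \<and> (\<forall>(w, x)\<in>forced_labels \<mu> B U. l w = x)"
proof -
  let ?L = "labelled_boxes \<mu> B U"
  have main: ?thesis if U: "U \<subseteq> B \<inter> III \<mu>" and l: "l \<in> ?L \<rightarrow>\<^sub>E V_lines"
  proof -
    have L_III: "?L \<subseteq> III \<mu>" "?L \<subseteq> B" by (auto simp: labelled_boxes_def)
    \<comment> \<open>The contrapositive of condition (2), split in two: the back neighbours of a
      missing type II cell that are boxes must be labelled, and their label is prescribed by the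
      kind of the cell.\<close>
    have II: "(\<forall>i. \<forall>w \<in> II_bar \<mu> i. (\<exists>n \<in> BN w \<inter> B. \<not> (n \<in> ?L \<and> l n = basis_line i)) \<longrightarrow> w \<in> B) \<longleftrightarrow>
      (\<forall>w \<in> II \<mu> - B. BN w \<inter> B \<subseteq> ?L) \<and> (\<forall>i. \<forall>w \<in> II_bar \<mu> i - B. \<forall>n \<in> BN w \<inter> ?L. l n = basis_line i)"
      using L_III(2) unfolding II_def by blast
    have "(\<forall>w \<in> III \<mu>. (induced_span \<mu> B U l w \<noteq> {0} \<longrightarrow> w \<in> B) \<and>
        (V.dim (induced_span \<mu> B U l w) = 1 \<longrightarrow> w \<in> ?L \<and> l w = induced_span \<mu> B U l w \<or> w \<in> U) \<and>
        (V.dim (induced_span \<mu> B U l w) = 2 \<longrightarrow> w \<in> U)) \<longleftrightarrow>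
      (\<forall>w \<in> III \<mu>. (BN w \<inter> B \<noteq> {} \<longrightarrow> w \<in> B) \<and>
        (w \<in> ?L \<longrightarrow> (\<forall>n \<in> BN w \<inter> B. n \<notin> U \<and> induced \<mu> U l n = l w)))" (is "?III \<longleftrightarrow> _")
      by (intro ball_cong refl III_condition_iff[OF \<mu> _ U l])
    also have "\<dots> \<longleftrightarrow> (\<forall>w \<in> III \<mu>. BN w \<inter> B \<noteq> {} \<longrightarrow> w \<in> B) \<and> (\<forall>w \<in> ?L. BN w \<inter> U = {}) \<and>
      (\<forall>w \<in> ?L. \<forall>n \<in> BN w \<inter> B. n \<notin> U \<longrightarrow> induced \<mu> U l n = l w)"
      using L_III U by blast
    finally have III: "?III \<longleftrightarrow> (\<forall>w \<in> III \<mu>. BN w \<inter> B \<noteq> {} \<longrightarrow> w \<in> B) \<and> (\<forall>w \<in> ?L. BN w \<inter> U = {}) \<and>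
      (\<forall>w \<in> ?L. \<forall>n \<in> BN w \<inter> B. n \<notin> U \<longrightarrow> induced \<mu> U l n = l w)" .
    \<comment> \<open>By \<open>BN_III_cases\<close> the neighbour is either of type III, giving an
      equation between labels, or lies in exactly one negative cylinder, giving a prescribed
      label.\<close>
    have ind: "(n \<notin> U \<longrightarrow> induced \<mu> U l n = l w) \<longleftrightarrow>
        (n \<in> ?L \<longrightarrow> l n = l w) \<and> (\<forall>j. n \<in> Cyl_neg \<mu> j \<longrightarrow> basis_line j = l w)"
      if w: "w \<in> ?L" and n: "n \<in> BN w \<inter> B" for n w
    proof -
      have wn: "w \<in> III \<mu>" "n \<in> BN w" using w n L_III by auto
      show ?thesis
        using \<mu> wn
      proof (rule BN_III_cases)
        assume III: "n \<in> III \<mu>"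
        then have "n \<notin> Cyl_neg \<mu> j" for j using Cyl_neg_disjoint by blast
        with III n show ?thesis by (auto simp: induced_def labelled_boxes_def)
      next
        fix k assume 2: "{j. n \<in> Cyl_neg \<mu> j} = {k}" "n \<in> I_neg \<mu>" "n \<notin> III \<mu>"
        then have "n \<notin> U" "n \<notin> ?L" using U L_III by auto
        moreover have "induced \<mu> U l n = basis_line k" using 2 by (simp add: induced_def)
        moreover have "n \<in> Cyl_neg \<mu> j \<longleftrightarrow> j = k" for j using 2(1) by auto
        ultimately show ?thesis by simp
      qed
    qed
    have F: "(\<forall>(w, x)\<in>forced_labels \<mu> B U. l w = x) \<longleftrightarrow>
      (\<forall>i. \<forall>w \<in> II_bar \<mu> i - B. \<forall>n \<in> BN w \<inter> ?L. l n = basis_line i) \<and>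
      (\<forall>w \<in> ?L. \<forall>n \<in> BN w \<inter> B. \<forall>j. n \<in> Cyl_neg \<mu> j \<longrightarrow> basis_line j = l w)"
    proof -
      have "(\<forall>(w, x)\<in>forced_labels \<mu> B U. l w = x) \<longleftrightarrow> (\<forall>w\<in>?L. \<forall>i.
        (\<exists>w' \<in> II_bar \<mu> i - B. w \<in> BN w') \<or> BN w \<inter> B \<inter> Cyl_neg \<mu> i \<noteq> {} \<longrightarrow> l w = basis_line i)"
        by (simp add: forced_labels_def) metis
      then show ?thesis unfolding eq_commute[of "basis_line _"] by blast
    qed
    have R: "(\<forall>(n, w)\<in>label_adjacency \<mu> B U. l n = l w) \<longleftrightarrow> (\<forall>w \<in> ?L. \<forall>n \<in> BN w \<inter> B. n \<in> ?L \<longrightarrow> l n = l w)"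
      unfolding label_adjacency_def using L_III by auto
    have adj: "(\<forall>w \<in> ?L. \<forall>n \<in> BN w \<inter> B. n \<notin> U \<longrightarrow> induced \<mu> U l n = l w) \<longleftrightarrow>
      (\<forall>w \<in> ?L. \<forall>n \<in> BN w \<inter> B. n \<in> ?L \<longrightarrow> l n = l w) \<and>
      (\<forall>w \<in> ?L. \<forall>n \<in> BN w \<inter> B. \<forall>j. n \<in> Cyl_neg \<mu> j \<longrightarrow> basis_line j = l w)"
      using ind unfolding ball_conj_distrib[symmetric] by (intro ball_cong refl) blast
    show ?thesis
      unfolding is_lbc_def lbc_base_def II F R III adj ball_Un using U l by argo
  qed
  show ?thesis
  proof (cases "U \<subseteq> B \<inter> III \<mu> \<and> l \<in> ?L \<rightarrow>\<^sub>E V_lines")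
    case True
    then show ?thesis using main by blast
  next
    case False
    then show ?thesis unfolding is_lbc_def lbc_base_def by argo
  qed
qed

text \<open>The unions of connected components of labelled boxes without a prescribed label.\<close>

definition free_unions :: "(3 \<Rightarrow> nat list) \<Rightarrow> cell set \<Rightarrow> cell set \<Rightarrow> cell set set" where
  "free_unions \<mu> B U = {T. T \<subseteq> labelled_boxes \<mu> B U \<and>
    (\<forall>(n, w)\<in>label_adjacency \<mu> B U. n \<in> T \<longleftrightarrow> w \<in> T) \<and> T \<inter> fst ` forced_labels \<mu> B U = {}}"

text \<open>For one and the same set \<open>K\<close>, the space of labellings is the power of the
  projective line indexed by \<open>K\<close>, and the free unions number
  \<open>2 ^ card K\<close>.\<close>

lemma chi_top_eq_card_free_unions:
  assumes \<mu>: "\<And>i. is_partition (\<mu> i)" and BU: "(B, U) \<in> lbc_families \<mu>"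
  shows "chi_top \<mu> B U = int (card (free_unions \<mu> B U))"
proof -
  let ?L = "labelled_boxes \<mu> B U"
  obtain l where l: "is_lbc \<mu> B U l" using BU by (auto simp: lbc_families_def)
  then have base: "lbc_base \<mu> B U" unfolding is_lbc_iff[of \<mu> B U l, OF \<mu>] by (rule conjunct1)
  have "finite ?L" using base by (auto simp: lbc_base_def labelled_boxes_def)
  moreover have "label_adjacency \<mu> B U \<subseteq> ?L \<times> ?L" by (auto simp: label_adjacency_def)
  moreover have "fst ` forced_labels \<mu> B U \<subseteq> ?L" by (auto simp: forced_labels_def)
  moreover have "{l. is_lbc \<mu> B U l} = {l \<in> ?L \<rightarrow>\<^sub>E topspace P1_topology.
      (\<forall>(n, w)\<in>label_adjacency \<mu> B U. l n = l w) \<and> (\<forall>(w, x)\<in>forced_labels \<mu> B U. l w = x)}"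
    unfolding is_lbc_iff[of \<mu> B U, OF \<mu>] topspace_P1_topology using base by simp
  moreover have "{l. is_lbc \<mu> B U l} \<noteq> {}" using l by blast
  ultimately obtain K :: "cell set" where K: "finite K"
    "subtopology (product_topology (\<lambda>_. P1_topology) ?L) {l. is_lbc \<mu> B U l}
      homeomorphic_space product_topology (\<lambda>_. P1_topology) K"
    "card (free_unions \<mu> B U) = 2 ^ card K"
    unfolding free_unions_def by (rule constrained_functions_free_components)
  then show ?thesis
    by (simp add: chi_top_def labellings_space_def euler_characteristic_homeomorphic_space
        euler_characteristic_P1_power)
qed

section \<open>AB configurations over a family of labellings\<close>

definition AB_fibre :: "(3 \<Rightarrow> nat list) \<Rightarrow> cell set \<Rightarrow> cell set \<Rightarrow> (cell set \<times> cell set) set" where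
  "AB_fibre \<mu> B U = {p. is_AB \<mu> p \<and> P_map \<mu> p = AB_base \<mu> B U}"

text \<open>Undoes \<open>P_map\<close> over a given base: \<open>P_map\<close> moves the type III
  cells found only in the second set to the first, and here \<open>T\<close> is moved back.\<close>

definition AB_lift :: "(3 \<Rightarrow> nat list) \<Rightarrow> cell set \<Rightarrow> cell set \<Rightarrow> cell set \<Rightarrow> cell set \<times> cell set" where
  "AB_lift \<mu> B U T = (B \<inter> (I_neg \<mu> \<union> III \<mu>) - T, (B \<inter> II \<mu>) \<union> U \<union> T)"

lemma AB_fibre_subset_AB_lift:
  assumes base: "lbc_base \<mu> B U" and p: "p \<in> AB_fibre \<mu> B U"
  shows "p \<in> AB_lift \<mu> B U ` free_unions \<mu> B U"
proof -
  let ?L = "labelled_boxes \<mu> B U"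
  obtain A' B' where p_eq: "p = (A', B')" by (cases p)
  \<comment> \<open>Exactly the cells moved by \<open>P_map\<close>; together with
    \<open>(B, U)\<close> they recover the pair.\<close>
  define T where "T = III \<mu> \<inter> (B' - A')"
  have P: "A' \<union> T = B \<inter> (I_neg \<mu> \<union> III \<mu>)" "B' - T = (B \<inter> II \<mu>) \<union> U"
    using p by (auto simp: AB_fibre_def P_map_def AB_base_def p_eq T_def)
  have A_closed: "\<And>w n. w \<in> I_neg \<mu> \<union> III \<mu> \<Longrightarrow> n \<in> BN w \<Longrightarrow> n \<in> A' \<Longrightarrow> w \<in> A'"
    and B_closed: "\<And>w n. w \<in> II \<mu> \<union> III \<mu> \<Longrightarrow> n \<in> BN w \<Longrightarrow> n \<in> B' \<Longrightarrow> w \<in> B'"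
    using p unfolding AB_fibre_def is_AB_def p_eq by auto
  have U: "U \<subseteq> B \<inter> III \<mu>" using base by (simp add: lbc_base_def)
  have T: "T \<inter> A' = {}" "T \<subseteq> B'" "T \<subseteq> III \<mu>" "T \<inter> U = {}" "T \<subseteq> B"
    using P unfolding T_def by blast+
  have A': "A' = B \<inter> (I_neg \<mu> \<union> III \<mu>) - T" and B': "B' = (B \<inter> II \<mu>) \<union> U \<union> T"
    using P T by blast+
  have "T \<subseteq> ?L" using T by (auto simp: labelled_boxes_def)
  \<comment> \<open>Closure of \<open>B'\<close> carries membership in \<open>T\<close> from
    \<open>n\<close> to \<open>w\<close>, and closure of \<open>A'\<close> carries it from
    \<open>w\<close> back to \<open>n\<close>.\<close>
  moreover have "n \<in> T \<longleftrightarrow> w \<in> T" if adj: "(n, w) \<in> label_adjacency \<mu> B U" for n w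
  proof
    have nw: "n \<in> BN w" "n \<in> III \<mu>" "w \<in> III \<mu>" "n \<in> B" "w \<notin> U"
      using adj unfolding label_adjacency_def labelled_boxes_def by blast+
    show "w \<in> T" if "n \<in> T"
    proof -
      have "w \<in> B'" using B_closed[of w n] that T(2) nw by blast
      then show ?thesis using nw II_III_disjoint unfolding B' by blast
    qed
    show "n \<in> T" if "w \<in> T"
    proof (rule ccontr)
      assume "n \<notin> T"
      then have "n \<in> A'" using nw unfolding A' by blast
      then have "w \<in> A'" using A_closed[of w n] nw by blast
      then show False using that T(1) by blast
    qed
  qed
  \<comment> \<open>A cell of \<open>T\<close> behind a missing type II cell would force that cell
    into \<open>B'\<close>; a cell of \<open>T\<close> in front of a box with a negative coordinate
    would be forced into \<open>A'\<close>.\<close>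
  moreover have "x \<notin> fst ` forced_labels \<mu> B U" if x: "x \<in> T" for x
  proof
    assume "x \<in> fst ` forced_labels \<mu> B U"
    then consider i w where "w \<in> II_bar \<mu> i - B" "x \<in> BN w"
      | n i where "n \<in> BN x" "n \<in> B" "n \<in> Cyl_neg \<mu> i"
      by (auto simp: forced_labels_def)
    then show False
    proof cases
      case (1 i w)
      then have w: "w \<in> II \<mu>" "w \<notin> B" by (auto simp: II_def)
      with 1 x T(2) have "w \<in> B'" using B_closed[of w x] by blast
      then show False using w U T(5) unfolding B' by blast
    next
      case (2 n i)
      then have "n \<in> I_neg \<mu>" "n \<notin> T" using Cyl_neg_disjoint T(3) by (auto simp: I_neg_def)
      then have "n \<in> A'" using 2 unfolding A' by blast
      then have "x \<in> A'" using A_closed[of x n] 2 x T(3) by blast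
      then show False using x T(1) by blast
    qed
  qed
  ultimately have "T \<in> free_unions \<mu> B U" unfolding free_unions_def by blast
  moreover have "p = AB_lift \<mu> B U T" by (simp add: AB_lift_def p_eq A' B')
  ultimately show ?thesis by blast
qed

lemma AB_lift_in_AB_fibre:
  assumes \<mu>: "\<And>i. is_partition (\<mu> i)" and base: "lbc_base \<mu> B U" and TF: "T \<in> free_unions \<mu> B U"
  shows "AB_lift \<mu> B U T \<in> AB_fibre \<mu> B U"
proof -
  let ?L = "labelled_boxes \<mu> B U"
  define A' where "A' = B \<inter> (I_neg \<mu> \<union> III \<mu>) - T"
  define B' where "B' = (B \<inter> II \<mu>) \<union> U \<union> T"
  have finB: "finite B" and U: "U \<subseteq> B \<inter> III \<mu>"
    and closed: "\<And>w n. w \<in> I_neg \<mu> \<union> III \<mu> \<Longrightarrow> n \<in> BN w \<Longrightarrow> n \<in> B \<Longrightarrow> w \<in> B"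
    and II: "\<And>w n. w \<in> II \<mu> - B \<Longrightarrow> n \<in> BN w \<Longrightarrow> n \<in> B \<Longrightarrow> n \<in> ?L"
    and L_U: "\<And>w n. w \<in> ?L \<Longrightarrow> n \<in> BN w \<Longrightarrow> n \<notin> U"
    using base unfolding lbc_base_def by blast+
  have L_iff: "w \<in> ?L \<longleftrightarrow> w \<in> B \<and> w \<in> III \<mu> \<and> w \<notin> U" for w by (auto simp: labelled_boxes_def)
  have T: "T \<subseteq> ?L" and forced: "T \<inter> fst ` forced_labels \<mu> B U = {}"
    using TF by (auto simp: free_unions_def)
  have adj: "n \<in> T \<longleftrightarrow> w \<in> T" if "n \<in> ?L" "w \<in> ?L" "n \<in> BN w" for n w
    using TF that unfolding free_unions_def label_adjacency_def by blast
  have forced_II: "n \<notin> T" if "w \<in> II \<mu> - B" "n \<in> BN w" for n w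
  proof
    assume "n \<in> T"
    obtain i where "w \<in> II_bar \<mu> i - B" using \<open>w \<in> II \<mu> - B\<close> by (auto simp: II_def)
    then have "(n, basis_line i) \<in> forced_labels \<mu> B U"
      using \<open>n \<in> BN w\<close> \<open>n \<in> T\<close> T unfolding forced_labels_def by blast
    then show False using forced \<open>n \<in> T\<close> by force
  qed
  have forced_I: "w \<notin> T" if "n \<in> I_neg \<mu>" "n \<in> B" "n \<in> BN w" for n w
  proof
    assume "w \<in> T"
    obtain i where "n \<in> Cyl_neg \<mu> i" using \<open>n \<in> I_neg \<mu>\<close> by (auto simp: I_neg_def)
    then have "(w, basis_line i) \<in> forced_labels \<mu> B U"
      using \<open>n \<in> BN w\<close> \<open>n \<in> B\<close> \<open>w \<in> T\<close> T unfolding forced_labels_def by blast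
    then show False using forced \<open>w \<in> T\<close> by force
  qed
  have A_closed: "w \<in> A'" if w: "w \<in> I_neg \<mu> \<union> III \<mu>" and n: "n \<in> BN w" "n \<in> A'" for w n
  proof -
    have nB: "n \<in> B" "n \<in> I_neg \<mu> \<union> III \<mu>" "n \<notin> T" using n(2) by (auto simp: A'_def)
    \<comment> \<open>Otherwise the back neighbour \<open>n\<close>, which is not in
      \<open>T\<close>, would give \<open>w\<close> a prescribed label, be unlabelled behind a
      labelled box, or be a labelled neighbour outside \<open>T\<close>; each is excluded.\<close>
    have "w \<notin> T"
    proof
      assume wT: "w \<in> T"
      then have wL: "w \<in> ?L" using T by blast
      have "n \<notin> I_neg \<mu>" using forced_I[of n w] nB n(1) wT by blast
      then have "n \<in> ?L" using nB L_U[OF wL n(1)] by (simp add: L_iff)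
      with adj[of n w] wL n(1) wT nB(3) show False by blast
    qed
    then show ?thesis using closed[OF w n(1) nB(1)] w by (simp add: A'_def)
  qed
  have B_closed: "w \<in> B'" if w: "w \<in> II \<mu> \<union> III \<mu>" and n: "n \<in> BN w" "n \<in> B'" for w n
  proof (cases "w \<in> II \<mu>")
    case True
    have "w \<in> B"
    proof (rule ccontr)
      assume "w \<notin> B"
      moreover have "n \<in> B" using n(2) U T by (auto simp: B'_def L_iff)
      ultimately have "n \<in> ?L" "n \<notin> T" using II[of w n] forced_II[of w n] True n(1) by blast+
      then show False using n(2) II_III_disjoint by (auto simp: B'_def L_iff)
    qed
    then show ?thesis using True by (simp add: B'_def)
  next
    case False
    then have w3: "w \<in> III \<mu>" using w by blast
    have n3: "n \<notin> II \<mu>"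
      using \<mu> w3 n(1)
    proof (rule BN_III_cases)
      show "n \<notin> II \<mu>" if "n \<in> III \<mu>" using that II_III_disjoint by blast
      show "n \<notin> II \<mu>" if "n \<in> I_neg \<mu>" using that I_neg_disjoint by blast
    qed
    then have "n \<in> U \<or> n \<in> T" using n(2) by (auto simp: B'_def)
    moreover have "n \<in> B" using calculation U T by (auto simp: L_iff)
    then have wB: "w \<in> B" using closed[of w n] w3 n(1) by blast
    ultimately show ?thesis
    proof (cases "w \<in> U")
      case False
      then have wL: "w \<in> ?L" using wB w3 by (simp add: L_iff)
      then have "n \<in> T" using L_U[OF wL n(1)] \<open>n \<in> U \<or> n \<in> T\<close> by blast
      then have "w \<in> T" using adj[of n w] wL n(1) T by blast
      then show ?thesis by (simp add: B'_def)
    qed (simp add: B'_def)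
  qed
  have fin: "finite A'" "finite B'"
  proof -
    have "A' \<subseteq> B" "B' \<subseteq> B" using U T by (auto simp: A'_def B'_def L_iff)
    then show "finite A'" "finite B'" using finB finite_subset by blast+
  qed
  have "A' \<subseteq> I_neg \<mu> \<union> III \<mu>" "B' \<subseteq> II \<mu> \<union> III \<mu>"
    using U T by (auto simp: A'_def B'_def L_iff)
  then have "is_AB \<mu> (A', B')"
    using fin A_closed B_closed unfolding is_AB_def by blast
  moreover have T': "T \<subseteq> B" "T \<subseteq> III \<mu>" "T \<inter> U = {}" using T L_iff by blast+
  \<comment> \<open>Unlabelled boxes lie in both \<open>A'\<close> and \<open>B'\<close>, so
    \<open>P_map\<close> moves none of them and moves precisely \<open>T\<close>.\<close>
  have eqT: "III \<mu> \<inter> (B' - A') = T"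
    using U T' II_III_disjoint[of \<mu>] unfolding A'_def B'_def by blast
  then have "P_map \<mu> (A', B') = (A' \<union> T, B' - T)" by (simp add: P_map_def)
  moreover have "A' \<union> T = B \<inter> (I_neg \<mu> \<union> III \<mu>)" "B' - T = (B \<inter> II \<mu>) \<union> U"
    using U T' II_III_disjoint[of \<mu>] unfolding A'_def B'_def by blast+
  ultimately show ?thesis
    by (simp add: AB_fibre_def AB_lift_def AB_base_def flip: A'_def B'_def)
qed

lemma card_AB_fibre:
  assumes \<mu>: "\<And>i. is_partition (\<mu> i)" and base: "lbc_base \<mu> B U"
  shows "card (AB_fibre \<mu> B U) = card (free_unions \<mu> B U)"
proof -
  have "inj_on (AB_lift \<mu> B U) (free_unions \<mu> B U)"
  proof (rule inj_onI)
    fix S T assume "S \<in> free_unions \<mu> B U" "T \<in> free_unions \<mu> B U"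
    \<comment> \<open>Free unions avoid type II cells and \<open>U\<close>, so they can be read off
      from the second component.\<close>
    then have "S \<inter> ((B \<inter> II \<mu>) \<union> U) = {}" "T \<inter> ((B \<inter> II \<mu>) \<union> U) = {}"
      using II_III_disjoint by (auto simp: free_unions_def labelled_boxes_def)
    moreover assume "AB_lift \<mu> B U S = AB_lift \<mu> B U T"
    ultimately show "S = T" unfolding AB_lift_def by blast
  qed
  moreover have "AB_fibre \<mu> B U = AB_lift \<mu> B U ` free_unions \<mu> B U"
    using AB_fibre_subset_AB_lift[OF base] AB_lift_in_AB_fibre[of \<mu>, OF \<mu> base] by blast
  ultimately show ?thesis by (simp add: card_image)
qed

text \<open>Moving \<open>T\<close> from one set to the other preserves the total size. For empty
  \<open>T\<close> the first set holds the boxes not of type II, and the second holds the type II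
  boxes together with a second copy of \<open>U\<close>.\<close>

lemma card_AB_lift:
  assumes base: "lbc_base \<mu> B U" and T: "T \<in> free_unions \<mu> B U"
  shows "card (fst (AB_lift \<mu> B U T)) + card (snd (AB_lift \<mu> B U T)) = card B + card U"
proof -
  let ?A = "B \<inter> (I_neg \<mu> \<union> III \<mu>)"
  have finB: "finite B" and B: "B \<subseteq> I_neg \<mu> \<union> II \<mu> \<union> III \<mu>" and U: "U \<subseteq> B \<inter> III \<mu>"
    using base by (auto simp: lbc_base_def)
  have TA: "T \<subseteq> ?A" "T \<inter> U = {}" "T \<inter> II \<mu> = {}"
    using T II_III_disjoint by (auto simp: free_unions_def labelled_boxes_def)
  have fin: "finite ?A" "finite T" "finite U"
    using finB U TA finite_subset[of _ B] by auto
  have disj: "?A \<inter> (B \<inter> II \<mu>) = {}" "(B \<inter> II \<mu>) \<inter> U = {}"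
    using U II_III_disjoint I_neg_disjoint by blast+
  have "B = ?A \<union> (B \<inter> II \<mu>)" using B by blast
  then have "card B = card ?A + card (B \<inter> II \<mu>)"
    using card_Un_disjoint[OF _ _ disj(1)] finB by (metis finite_Int)
  moreover have "card (?A - T) + card T = card ?A"
    using TA(1) fin by (metis card_Diff_subset card_mono le_add_diff_inverse2)
  moreover have "card ((B \<inter> II \<mu>) \<union> U \<union> T) = card (B \<inter> II \<mu>) + card U + card T"
    using disj TA fin finB by (subst card_Un_disjoint; (subst card_Un_disjoint)?) auto
  ultimately show ?thesis by (simp add: AB_lift_def)
qed

text \<open>The second component mixes type II boxes with \<open>U\<close>, but these are told apart
  by the type of the cell. Hence fibres over distinct families are disjoint.\<close>

lemma AB_base_inject:
  assumes "lbc_base \<mu> B U" "lbc_base \<mu> B' U'" "AB_base \<mu> B U = AB_base \<mu> B' U'"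
  shows "B = B' \<and> U = U'"
proof -
  have rec: "B = fst (AB_base \<mu> B U) \<union> snd (AB_base \<mu> B U) \<inter> II \<mu>" "U = snd (AB_base \<mu> B U) \<inter> III \<mu>"
    if "lbc_base \<mu> B U" for B U
    using that II_III_disjoint by (auto simp: AB_base_def lbc_base_def)
  show ?thesis using rec[OF assms(1)] rec[OF assms(2)] assms(3) by simp
qed

section \<open>Comparison of the generating functions\<close>

text \<open>Coefficient extraction commutes with the infinite sum because sufficiently close series
  in the \<open>q\<close>-adic metric agree in coefficient \<open>k\<close>.\<close>

lemma fls_nth_infsum:
  fixes c :: "'s \<Rightarrow> int" and wt :: "'s \<Rightarrow> nat"
  assumes fin: "\<And>n. finite {s \<in> S. wt s = n}"
  shows "fls_nth (\<Sum>\<^sub>\<infinity>s\<in>S. of_int (c s) * fls_X ^ wt s) k = (\<Sum>s | s \<in> S \<and> int (wt s) = k. c s)"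
proof -
  define f where "f = (\<lambda>s. of_int (c s) * fls_X ^ wt s :: int fls)"
  define F where "F = infsum f S"
  have f_nth: "fls_nth (f s) k = (if int (wt s) = k then c s else 0)" for s
    by (auto simp: f_def fls_of_int)
  have "(f has_sum F) S"
    unfolding F_def using fls_summable_on[OF fin, of c] by (intro has_sum_infsum) (simp add: f_def)
  \<comment> \<open>Distance below this bound forces the difference to have subdegree above
    \<open>k\<close>; for negative \<open>k\<close> the bound is \<open>1\<close>, since
    \<open>nat k\<close> is then \<open>0\<close>.\<close>
  then have "\<forall>\<^sub>F X in finite_subsets_at_top S. dist (sum f X) F < inverse (2 ^ nat k)"
    unfolding has_sum_def by (rule tendstoD) simp
  then obtain T where T: "finite T" "T \<subseteq> S"
    "\<And>X. finite X \<Longrightarrow> T \<subseteq> X \<Longrightarrow> X \<subseteq> S \<Longrightarrow> dist (sum f X) F < inverse (2 ^ nat k)"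
    unfolding eventually_finite_subsets_at_top by metis
  \<comment> \<open>Adding all indices of weight \<open>k\<close> makes the finite sum already carry
    the complete coefficient.\<close>
  define X where "X = T \<union> {s \<in> S. int (wt s) = k}"
  have "{s \<in> S. int (wt s) = k} \<subseteq> {s \<in> S. wt s = nat k}" by auto
  then have X: "finite X" "T \<subseteq> X" "X \<subseteq> S"
    using T(1,2) finite_subset[OF _ fin] by (auto simp: X_def)
  have "fls_nth (sum f X - F) k = 0"
  proof (cases "sum f X = F")
    case False
    have less: "dist (sum f X) F < inverse (2 ^ nat k)" using T(3)[OF X] .
    have "k < fls_subdegree (sum f X - F)"
    proof (rule ccontr)
      let ?d = "fls_subdegree (sum f X - F)"
      assume "\<not> k < ?d"
      then have le: "?d \<le> k" by simp
      have "inverse (2 ^ nat k) \<le> dist (sum f X) F"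
      proof (cases "?d \<ge> 0")
        case True
        then have "(2::real) ^ nat ?d \<le> 2 ^ nat k" using le by (intro power_increasing) auto
        then have "inverse (2 ^ nat k) \<le> inverse ((2::real) ^ nat ?d)" by (intro le_imp_inverse_le) auto
        then show ?thesis using False True by (simp add: dist_fls_def)
      next
        case neg: False
        have "inverse (2 ^ nat k) \<le> (1::real)" by (simp add: inverse_le_1_iff)
        also have "\<dots> \<le> 2 ^ nat (- ?d)" by simp
        finally show ?thesis using False neg by (simp add: dist_fls_def)
      qed
      then show False using less by simp
    qed
    then show ?thesis by (rule fls_eq0_below_subdegree)
  qed simp
  then have "fls_nth F k = (\<Sum>s\<in>X. if int (wt s) = k then c s else 0)"
    by (simp add: fls_nth_sum f_nth)
  also have "\<dots> = (\<Sum>s | s \<in> X \<and> int (wt s) = k. c s)"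
    using X(1) by (simp add: sum.If_cases Int_def)
  also have "{s. s \<in> X \<and> int (wt s) = k} = {s. s \<in> S \<and> int (wt s) = k}"
    using T(2) by (auto simp: X_def)
  finally show ?thesis by (simp add: F_def f_def)
qed

lemma finite_lbc_families_weight:
  "finite {s \<in> lbc_families \<mu>. card (fst s) + card (snd s) = n}"
proof (rule finite_subset)
  let ?C = "{S. finite S \<and> card S \<le> n \<and> S \<subseteq> I_neg \<mu> \<union> II \<mu> \<union> III \<mu> \<and>
    (\<forall>w \<in> I_neg \<mu>. BN w \<inter> S \<noteq> {} \<longrightarrow> w \<in> S)}"
  show "{s \<in> lbc_families \<mu>. card (fst s) + card (snd s) = n} \<subseteq> ?C \<times> Pow (III \<mu>)"
    by (auto simp: lbc_families_def is_lbc_def)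
  show "finite (?C \<times> Pow (III \<mu>))"
    using finite_small_configurations finite_II_III by blast
qed

theorem theorem4p39:
  fixes \<mu> :: "3 \<Rightarrow> nat list"
  assumes "\<And>i. is_partition (\<mu> i)"
  shows "Z_AB \<mu> = W \<mu>"
proof -
  let ?wt = "\<lambda>s :: cell set \<times> cell set. card (fst s) + card (snd s)"
  let ?fib = "\<lambda>s. AB_fibre \<mu> (fst s) (snd s)"
  have base: "lbc_base \<mu> (fst s) (snd s)" if s: "s \<in> lbc_families \<mu>" for s
  proof -
    obtain l where "is_lbc \<mu> (fst s) (snd s) l" using s by (auto simp: lbc_families_def)
    then show ?thesis unfolding is_lbc_iff[of \<mu> "fst s" "snd s" l, OF assms] by (rule conjunct1)
  qed
  have wt: "?wt p = ?wt s" if s: "s \<in> lbc_families \<mu>" and p: "p \<in> ?fib s" for s p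
    using AB_fibre_subset_AB_lift[OF base[OF s] p] card_AB_lift[OF base[OF s]] by auto
  have card_fib: "chi_top \<mu> (fst s) (snd s) = int (card (?fib s))" if s: "s \<in> lbc_families \<mu>" for s
    using chi_top_eq_card_free_unions[of \<mu> "fst s" "snd s", OF assms]
      card_AB_fibre[of \<mu> "fst s" "snd s", OF assms base[OF s]] s by simp
  have fin_fib: "finite (?fib s)" if s: "s \<in> lbc_families \<mu>" for s
  proof (rule finite_subset)
    show "?fib s \<subseteq> AB_lift \<mu> (fst s) (snd s) ` free_unions \<mu> (fst s) (snd s)"
      using AB_fibre_subset_AB_lift[OF base[OF s]] by blast
    have "free_unions \<mu> (fst s) (snd s) \<subseteq> Pow (fst s)"
      by (auto simp: free_unions_def labelled_boxes_def)
    then have "finite (free_unions \<mu> (fst s) (snd s))"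
      by (rule finite_subset) (use base[OF s] in \<open>simp add: lbc_base_def\<close>)
    then show "finite (AB_lift \<mu> (fst s) (snd s) ` free_unions \<mu> (fst s) (snd s))" by simp
  qed
  have disj: "?fib s \<inter> ?fib t = {}" if "s \<in> lbc_families \<mu>" "t \<in> lbc_families \<mu>" "s \<noteq> t" for s t
    using AB_base_inject[OF base[OF that(1)] base[OF that(2)]] that(3)
    by (auto simp: AB_fibre_def prod_eq_iff)
  \<comment> \<open>The fibres partition \<open>AB_set\<close>, and by \<open>wt\<close> they
    respect weights, so every weight level is a finite disjoint union of fibres.\<close>
  have AB: "{p \<in> AB_set \<mu>. ?wt p = n} = (\<Union>s\<in>{s \<in> lbc_families \<mu>. ?wt s = n}. ?fib s)" for n
  proof -
    have "p \<in> AB_set \<mu> \<longleftrightarrow> (\<exists>s\<in>lbc_families \<mu>. p \<in> ?fib s)" for p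
      unfolding AB_set_def lbc_families_def AB_fibre_def by fastforce
    then show ?thesis using wt by auto
  qed
  have fin_AB: "finite {p \<in> AB_set \<mu>. ?wt p = n}" for n
    unfolding AB using finite_lbc_families_weight fin_fib by (intro finite_UN_I) auto
  \<comment> \<open>The coefficient \<open>of_int 1\<close> puts the left-hand sum into the form of
    \<open>fls_nth_infsum\<close>; the comparison is then made coefficientwise, by counting each
    fibre.\<close>
  have "(\<Sum>\<^sub>\<infinity>p\<in>AB_set \<mu>. of_int 1 * fls_X ^ ?wt p) =
      (\<Sum>\<^sub>\<infinity>s\<in>lbc_families \<mu>. of_int (chi_top \<mu> (fst s) (snd s)) * fls_X ^ ?wt s :: int fls)"
  proof (rule fls_eqI)
    fix k :: int
    let ?lev = "\<lambda>S. {s. s \<in> S \<and> int (?wt s) = k}"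
    show "fls_nth (\<Sum>\<^sub>\<infinity>p\<in>AB_set \<mu>. of_int 1 * fls_X ^ ?wt p) k =
      fls_nth (\<Sum>\<^sub>\<infinity>s\<in>lbc_families \<mu>. of_int (chi_top \<mu> (fst s) (snd s)) * fls_X ^ ?wt s :: int fls) k"
      unfolding fls_nth_infsum[OF fin_AB] fls_nth_infsum[OF finite_lbc_families_weight]
    proof (cases "k < 0")
      case False
      then obtain n where k: "k = int n" by (metis nonneg_int_cases not_less)
      have "(\<Sum>p | p \<in> AB_set \<mu> \<and> int (?wt p) = k. 1) = int (card {p \<in> AB_set \<mu>. ?wt p = n})"
        by (simp add: k flip: of_nat_add)
      also have "\<dots> = (\<Sum>s | s \<in> lbc_families \<mu> \<and> ?wt s = n. int (card (?fib s)))"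
        unfolding AB using finite_lbc_families_weight fin_fib disj
        by (subst card_UN_disjoint) auto
      also have "\<dots> = (\<Sum>s | s \<in> lbc_families \<mu> \<and> int (?wt s) = k. chi_top \<mu> (fst s) (snd s))"
        by (intro sum.cong) (auto simp: k card_fib)
      finally show "(\<Sum>p | p \<in> AB_set \<mu> \<and> int (?wt p) = k. 1) = \<dots>" .
    qed auto
  qed
  then show ?thesis
    unfolding Z_AB_def W_def by (simp add: case_prod_unfold)
qed

end
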